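(* Let $(n_k)_{k\ge0}$ be a sequence of integers and, for $\varepsilon>0$, let $$\mathcal{R}_\varepsilon^{(n_k)}=\Bigl\{\mu\in\mathcal{P}(\mathbb{T}) : \limsup_{k\to\infty}|\widehat{\mu}(n_k)-1|<\varepsilon\Bigr\}.$$ Then $(n_k)_{k\ge0}$ is a rigidity sequence if and only if all the sets $\mathcal{R}_\varepsilon^{(n_k)}$, $\varepsilon>0$, are dense in $\mathcal{P}(\mathbb{T})$.
   Context: $\mathbb{T}=\{z\in\mathbb{C}: |z|=1\}$. $\mathcal{P}(\mathbb{T})$ is the set of Borel probability measures on $\mathbb{T}$, endowed with the topology of weak convergence of measures. $\mathcal{P}_c(\mathbb{T})$ is the set of $\mu\in\mathcal{P}(\mathbb{T})$ which are continuous, i.e. $\mu(\{z\})=0$ for every $z\in\mathbb{T}$. For $n\in\mathbb{Z}$, $\widehat{\mu}(n)=\int_{\mathbb{T}} z^n\,d\mu(z)$. A sequence of integers $(n_k)_{k\ge 0}$ is a rigidity sequence if there exists $\mu\in\mathcal{P}_c(\mathbb{T})$ such that $\widehat{\mu}(n_k)\to 1$ as $k\to\infty$. (For sequences of positive integers this is known to be equivalent to the existence of a weakly mixing measure-preserving system $(X,\mathcal{B},m;T)$ on a probability space such that $m(T^{-n_k}A\,\Delta\,A)\to 0$ for every $A\in\mathcal{B}$.) *)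

theory Defs
  imports "HOL-Probability.Probability"
begin

abbreviation unit_circle :: "complex set" where
  "unit_circle \<equiv> sphere 0 1"

text \<open>Borel probability measures on the circle have the circle itself (not the whole complex
  plane) as underlying space.\<close>

definition circle_prob :: "complex measure set" where
  "circle_prob = {\<mu>. sets \<mu> = sets (restrict_space borel unit_circle) \<and> prob_space \<mu>}"

definition circle_prob_cont :: "complex measure set" where
  "circle_prob_cont = {\<mu> \<in> circle_prob. \<forall>z \<in> unit_circle. emeasure \<mu> {z} = 0}"

text \<open>The topology of weak convergence is the initial topology for the maps
  \<open>\<mu> \<mapsto> \<integral> f d\<mu>\<close> with \<open>f\<close> a continuous function on the circle; by compactness such
  an \<open>f\<close> is automatically bounded.\<close>

definition weak_topology :: "complex measure topology" where
  "weak_topology = topology_generated_by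
     {{\<mu> \<in> circle_prob. (\<integral>z. f z \<partial>\<mu>) \<in> U} | (f :: complex \<Rightarrow> real) U.
        continuous_on unit_circle f \<and> open U}"

lemma topspace_weak_topology [simp]: "topspace weak_topology = circle_prob"
proof -
  have "circle_prob \<in> {{\<mu> \<in> circle_prob. (\<integral>z. f z \<partial>\<mu>) \<in> U} | (f :: complex \<Rightarrow> real) U.
        continuous_on unit_circle f \<and> open U}"
    unfolding mem_Collect_eq by (rule exI[of _ "\<lambda>_. 0"], rule exI[of _ UNIV]) simp
  then show ?thesis
    unfolding weak_topology_def topology_generated_by_topspace by blast
qed

lemma limitin_weak_topology:
  "limitin weak_topology X \<mu> F \<longleftrightarrow>
     \<mu> \<in> circle_prob \<and> (\<forall>\<^sub>F i in F. X i \<in> circle_prob) \<and>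
     (\<forall>f :: complex \<Rightarrow> real. continuous_on unit_circle f \<longrightarrow>
        ((\<lambda>i. \<integral>z. f z \<partial>X i) \<longlongrightarrow> (\<integral>z. f z \<partial>\<mu>)) F)"
  (is "?L \<longleftrightarrow> ?R")
proof
  assume L: ?L
  have "\<forall>\<^sub>F i in F. X i \<in> topspace weak_topology"
    using L unfolding limitin_def by blast
  moreover have "((\<lambda>i. \<integral>z. f z \<partial>X i) \<longlongrightarrow> (\<integral>z. f z \<partial>\<mu>)) F"
    if f: "continuous_on unit_circle f" for f :: "complex \<Rightarrow> real"
  proof (rule topological_tendstoI)
    fix U :: "real set" assume U: "open U" "(\<integral>z. f z \<partial>\<mu>) \<in> U"
    have "openin weak_topology {\<mu> \<in> circle_prob. (\<integral>z. f z \<partial>\<mu>) \<in> U}"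
      unfolding weak_topology_def by (rule topology_generated_by_Basis) (use f U in blast)
    moreover have "\<mu> \<in> {\<mu> \<in> circle_prob. (\<integral>z. f z \<partial>\<mu>) \<in> U}"
      using L U by (auto simp: limitin_def)
    ultimately have "\<forall>\<^sub>F i in F. X i \<in> {\<mu> \<in> circle_prob. (\<integral>z. f z \<partial>\<mu>) \<in> U}"
      using L unfolding limitin_def by blast
    then show "\<forall>\<^sub>F i in F. (\<integral>z. f z \<partial>X i) \<in> U"
      by (rule eventually_mono) blast
  qed
  ultimately show ?R
    using L by (simp add: limitin_def)
next
  assume R: ?R
  have "\<mu> \<in> S \<longrightarrow> (\<forall>\<^sub>F i in F. X i \<in> S)" if "openin weak_topology S" for S
    using that unfolding weak_topology_def openin_topology_generated_by_iff
  proof (induction rule: generate_topology_on.induct)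
    case Empty
    then show ?case by simp
  next
    case (Int A B)
    then show ?case by (auto simp: eventually_conj_iff)
  next
    case (UN K)
    show ?case
    proof
      assume "\<mu> \<in> \<Union>K"
      then obtain A where A: "A \<in> K" "\<mu> \<in> A" by blast
      then have "\<forall>\<^sub>F i in F. X i \<in> A" using UN by blast
      then show "\<forall>\<^sub>F i in F. X i \<in> \<Union>K"
        by (rule eventually_mono) (use A in blast)
    qed
  next
    case (Basis S)
    then obtain f :: "complex \<Rightarrow> real" and U where
      S: "S = {\<mu> \<in> circle_prob. (\<integral>z. f z \<partial>\<mu>) \<in> U}" "continuous_on unit_circle f" "open U"
      by blast
    show ?case
    proof
      assume "\<mu> \<in> S"
      then have "(\<integral>z. f z \<partial>\<mu>) \<in> U" by (simp add: S)
      moreover have "((\<lambda>i. \<integral>z. f z \<partial>X i) \<longlongrightarrow> (\<integral>z. f z \<partial>\<mu>)) F"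
        using R S(2) by simp
      ultimately have "\<forall>\<^sub>F i in F. (\<integral>z. f z \<partial>X i) \<in> U"
        using S(3) topological_tendstoD by metis
      with R show "\<forall>\<^sub>F i in F. X i \<in> S"
        by (simp add: S eventually_conj_iff)
    qed
  qed
  then show ?L
    using R by (simp add: limitin_def)
qed

definition fourier_coeff :: "complex measure \<Rightarrow> int \<Rightarrow> complex" where
  "fourier_coeff \<mu> n = (\<integral>z. z powi n \<partial>\<mu>)"

definition rigidity_sequence :: "(nat \<Rightarrow> int) \<Rightarrow> bool" where
  "rigidity_sequence n \<longleftrightarrow>
     (\<exists>\<mu> \<in> circle_prob_cont. (\<lambda>k. fourier_coeff \<mu> (n k)) \<longlonglongrightarrow> 1)"

definition rigidity_set :: "(nat \<Rightarrow> int) \<Rightarrow> real \<Rightarrow> complex measure set" where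
  "rigidity_set n \<epsilon> =
     {\<mu> \<in> circle_prob. limsup (\<lambda>k. ereal (cmod (fourier_coeff \<mu> (n k) - 1))) < ereal \<epsilon>}"

end

theory Submission
  imports Defs
begin

text \<open>Suppose a continuous measure \<open>\<mu>\<close> witnesses rigidity. It charges every neighbourhood of some \<open>w\<close>
  that is not a root of unity. Restricting \<open>\<mu>\<close> to a small set around \<open>w\<close> and pushing it forward
  under \<open>z \<mapsto> z ^ m\<close> preserves rigidity, and the powers of \<open>w\<close> are dense, so that rigid measures
  exist arbitrarily close to any point mass. Mixtures of these are dense.

  Conversely, let all the sets \<open>R\<^sub>\<epsilon>\<close> be dense. Given \<open>\<mu>\<close>, choose successively measures in \<open>R\<^sub>\<epsilon>\<close>
  that agree with \<open>\<mu>\<close> on longer and longer initial segments of the sequence, such that the windows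
  of indices on which they agree neither with \<open>\<mu>\<close> nor, up to \<open>\<epsilon>\<close>, with the constant 1 are
  disjoint. The average of many of them lies in \<open>R\<^sub>\<epsilon>\<close>, and for no index does it increase the distance
  of the Fourier coefficient from 1 by more than an arbitrarily small amount. Iterating with
  \<open>\<epsilon> = 2\<^sup>-\<^sup>p\<close>, while keeping the atoms small by finitely many weakly open conditions, a weak limit
  point of the resulting measures is continuous and rigid.\<close>

section \<open>Measures on the circle and their Fourier coefficients\<close>

abbreviation circle_borel :: "complex measure" where
  "circle_borel \<equiv> restrict_space borel unit_circle"

lemma circle_probD:
  assumes "\<mu> \<in> circle_prob"
  shows "prob_space \<mu>" "sets \<mu> = sets circle_borel" "space \<mu> = unit_circle"
  using assms sets_eq_imp_space_eq[of \<mu> circle_borel]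
  by (auto simp: circle_prob_def space_restrict_space)

lemma circle_borel_setsI: "A \<in> sets borel \<Longrightarrow> A \<subseteq> unit_circle \<Longrightarrow> A \<in> sets circle_borel"
  by (auto simp: sets_restrict_space_iff)

lemma continuous_on_circle_measurable:
  fixes f :: "complex \<Rightarrow> 'b::topological_space"
  assumes "continuous_on unit_circle f"
  shows "f \<in> borel_measurable circle_borel"
  using assms by (rule borel_measurable_continuous_on_restrict)

lemma borel_measurable_circle_prob:
  fixes f :: "complex \<Rightarrow> 'b::topological_space"
  assumes "\<mu> \<in> circle_prob" "continuous_on unit_circle f"
  shows "f \<in> borel_measurable \<mu>"
  using continuous_on_circle_measurable[OF assms(2)]
  by (simp add: measurable_cong_sets[OF circle_probD(2)[OF assms(1)] refl])

lemma continuous_on_circle_bounded: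
  fixes f :: "complex \<Rightarrow> 'b::real_normed_vector"
  assumes "continuous_on unit_circle f"
  obtains B where "B > 0" "\<And>z. z \<in> unit_circle \<Longrightarrow> norm (f z) \<le> B"
proof -
  have "bounded (f ` unit_circle)"
    using assms by (intro compact_imp_bounded compact_continuous_image) auto
  then show ?thesis
    using that by (auto simp: bounded_pos)
qed

lemma integrable_circle_prob:
  fixes f :: "complex \<Rightarrow> 'b::{banach, second_countable_topology}"
  assumes "\<mu> \<in> circle_prob" "continuous_on unit_circle f"
  shows "integrable \<mu> f"
proof -
  interpret prob_space \<mu> using assms by (simp add: circle_probD)
  obtain B where "\<And>z. z \<in> unit_circle \<Longrightarrow> norm (f z) \<le> B"
    using continuous_on_circle_bounded[OF assms(2)] by metis
  then show ?thesis
    using assms by (intro integrable_const_bound[of _ B])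
      (auto intro: borel_measurable_circle_prob AE_I2 simp: circle_probD(3)[OF assms(1)])
qed

lemma continuous_on_circle_powi [continuous_intros]:
  "continuous_on unit_circle (\<lambda>z::complex. z powi m)"
  by (intro continuous_intros) auto

lemma integral_distr_circle:
  fixes f :: "complex \<Rightarrow> 'b::{banach, second_countable_topology}"
  assumes "g \<in> M \<rightarrow>\<^sub>M circle_borel" "continuous_on unit_circle f"
  shows "(\<integral>z. f z \<partial>distr M circle_borel g) = (\<integral>x. f (g x) \<partial>M)"
  by (intro integral_distr assms continuous_on_circle_measurable)

lemma distr_circle_prob:
  assumes "prob_space M" "g \<in> M \<rightarrow>\<^sub>M circle_borel"
  shows "distr M circle_borel g \<in> circle_prob"
  using prob_space.prob_space_distr[OF assms] by (simp add: circle_prob_def)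

lemma cmod_fourier_coeff_le: 
  assumes "\<mu> \<in> circle_prob"
  shows "cmod (fourier_coeff \<mu> m) \<le> 1"
proof -
  interpret prob_space \<mu> using assms by (simp add: circle_probD)
  have "cmod (fourier_coeff \<mu> m) \<le> (\<integral>z. cmod (z powi m) \<partial>\<mu>)"
    unfolding fourier_coeff_def by (rule integral_norm_bound)
  also have "\<dots> = (\<integral>z. 1 \<partial>\<mu>)"
    by (rule Bochner_Integration.integral_cong) (auto simp: circle_probD(3)[OF assms] norm_power_int)
  finally show ?thesis by (simp add: prob_space)
qed

lemma Re_Im_fourier_coeff:
  assumes "\<mu> \<in> circle_prob"
  shows "Re (fourier_coeff \<mu> m) = (\<integral>z. Re (z powi m) \<partial>\<mu>)"
        "Im (fourier_coeff \<mu> m) = (\<integral>z. Im (z powi m) \<partial>\<mu>)"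
  using integrable_circle_prob[OF assms continuous_on_circle_powi, of m]
  by (simp_all add: fourier_coeff_def)

section \<open>Mixtures\<close>

text \<open>Mixtures are formed with the monadic \<open>bind\<close>, so that the same facts serve
  both a mixture indexed by the points of the circle and a finite average.\<close>

lemma
  assumes M: "prob_space M" and N: "N \<in> M \<rightarrow>\<^sub>M subprob_algebra circle_borel"
    and P: "\<And>x. x \<in> space M \<Longrightarrow> N x \<in> circle_prob"
  shows bind_circle_prob: "bind M N \<in> circle_prob"
    and integral_bind_circle: "\<And>f :: complex \<Rightarrow> real. continuous_on unit_circle f \<Longrightarrow>
      (\<integral>z. f z \<partial>bind M N) = (\<integral>x. (\<integral>z. f z \<partial>N x) \<partial>M)"
    and emeasure_bind_circle: "\<And>A. A \<in> sets circle_borel \<Longrightarrow>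
      emeasure (bind M N) A = (\<integral>\<^sup>+x. emeasure (N x) A \<partial>M)"
proof -
  interpret prob_space M by fact
  have "prob_space (bind M N)"
    by (rule prob_space_bind[OF _ N]) (auto intro!: AE_I2 circle_probD P)
  moreover have "sets (bind M N) = sets circle_borel"
    by (rule sets_bind) (auto simp: circle_probD(2)[OF P] not_empty)
  ultimately show "bind M N \<in> circle_prob"
    by (simp add: circle_prob_def)
  show "emeasure (bind M N) A = (\<integral>\<^sup>+x. emeasure (N x) A \<partial>M)" if "A \<in> sets circle_borel" for A
    using that by (intro emeasure_bind[OF not_empty N])
  show "(\<integral>z. f z \<partial>bind M N) = (\<integral>x. (\<integral>z. f z \<partial>N x) \<partial>M)"
    if f: "continuous_on unit_circle f" for f :: "complex \<Rightarrow> real"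
  proof -
    obtain B where B: "\<And>z. z \<in> unit_circle \<Longrightarrow> norm (f z) \<le> B"
      using continuous_on_circle_bounded[OF f] by metis
    \<comment> \<open>\<open>bind\<close> is the join of the image of \<open>M\<close> under
      \<open>N\<close>. Integrating against a join asks for a bounded function; compactness of the
      circle supplies the bound \<open>B\<close>.\<close>
    have "(\<integral>z. f z \<partial>bind M N) = (\<integral>M'. (\<integral>z. f z \<partial>M') \<partial>distr M (subprob_algebra circle_borel) N)"
      unfolding bind_nonempty''[OF N not_empty]
    proof (rule integral_join[where B'=1])
      show "finite_measure (distr M (subprob_algebra circle_borel) N)"
        using N by (intro prob_space.finite_measure prob_space_distr)
      show "AE M' in distr M (subprob_algebra circle_borel) N. emeasure M' (space M') \<le> ennreal 1"
        by (rule AE_I2) (auto simp: space_subprob_algebra subprob_space.emeasure_space_le_1)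
    qed (use B in \<open>auto intro: continuous_on_circle_measurable f simp: space_restrict_space\<close>)
    also have "\<dots> = (\<integral>x. (\<integral>z. f z \<partial>N x) \<partial>M)"
      by (rule integral_distr[OF N])
         (intro integral_measurable_subprob_algebra continuous_on_circle_measurable f)
    finally show ?thesis .
  qed
qed

text \<open>Split into real and imaginary parts because \<open>integral_bind_circle\<close> concerns
  real functions.\<close>

lemma fourier_coeff_bind:
  assumes M: "prob_space M" and N: "N \<in> M \<rightarrow>\<^sub>M subprob_algebra circle_borel"
    and P: "\<And>x. x \<in> space M \<Longrightarrow> N x \<in> circle_prob"
  shows "Re (fourier_coeff (bind M N) m) = (\<integral>x. Re (fourier_coeff (N x) m) \<partial>M)"
        "Im (fourier_coeff (bind M N) m) = (\<integral>x. Im (fourier_coeff (N x) m) \<partial>M)"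
proof -
  have "continuous_on unit_circle (\<lambda>z::complex. Re (z powi m))"
       "continuous_on unit_circle (\<lambda>z::complex. Im (z powi m))"
    by (auto intro!: continuous_intros)
  note * = this[THEN integral_bind_circle[OF M N P, rotated]]
  show "Re (fourier_coeff (bind M N) m) = (\<integral>x. Re (fourier_coeff (N x) m) \<partial>M)"
       "Im (fourier_coeff (bind M N) m) = (\<integral>x. Im (fourier_coeff (N x) m) \<partial>M)"
    using bind_circle_prob[OF assms]
    by (auto simp: Re_Im_fourier_coeff * P intro!: Bochner_Integration.integral_cong)
qed

text \<open>Every function on a discrete space is measurable. A family of measures chosen without
  any regularity thus becomes a kernel once its parameter factors through such a space.\<close>

lemma measurable_subprob_algebra_via_countable:
  assumes "g \<in> M \<rightarrow>\<^sub>M count_space UNIV" "\<And>i. \<nu> i \<in> circle_prob"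
  shows "(\<lambda>x. \<nu> (g x)) \<in> M \<rightarrow>\<^sub>M subprob_algebra circle_borel"
  using assms(1)
proof (rule measurable_compose)
  show "\<nu> \<in> count_space UNIV \<rightarrow>\<^sub>M subprob_algebra circle_borel"
    using assms(2) by (auto simp: space_subprob_algebra circle_prob_def intro: prob_space_imp_subprob_space)
qed

section \<open>Approximation by mixtures of localised measures\<close>

lemma dist_cis_le: "dist (cis s) (cis t) \<le> \<bar>s - t\<bar>"
proof -
  have "cis s - cis t = cis t * (cis (s - t) - 1)"
    by (simp add: algebra_simps cis_mult)
  then have "dist (cis s) (cis t) = cmod (cis (s - t) - 1)"
    by (simp add: dist_norm norm_mult)
  also have "\<dots> = cmod (exp (\<i> * of_real (s - t)) - 1)"
    by (simp add: cis_conv_exp)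
  also have "\<dots> \<le> \<bar>s - t\<bar>"
    unfolding dist_exp_i_1 using abs_sin_x_le_abs_x[of "(s - t) / 2"] by simp
  finally show ?thesis .
qed

text \<open>\<open>Arg\<close> is continuous off the closed negative real axis, constantly
  \<open>pi\<close> on that axis without its endpoint, and 0 at the endpoint.\<close>

lemma borel_measurable_Arg [measurable]: "Arg \<in> borel_measurable borel"
proof -
  have "(\<lambda>z. indicator (- \<real>\<^sub>\<le>\<^sub>0) z *\<^sub>R Arg z) \<in> borel_measurable borel"
    by (intro borel_measurable_continuous_on_indicator)
       (auto intro!: continuous_at_imp_continuous_on continuous_at_Arg borel_open simp: closed_nonpos_Reals_complex)
  moreover have "(\<lambda>z::complex. indicator (\<real>\<^sub>\<le>\<^sub>0 - {0}) z * pi) \<in> borel_measurable borel"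
    by (intro borel_measurable_times borel_measurable_indicator borel_measurable_const)
       (intro sets.Diff borel_closed closed_nonpos_Reals_complex closed_singleton)
  ultimately have "(\<lambda>z. indicator (- \<real>\<^sub>\<le>\<^sub>0) z *\<^sub>R Arg z + indicator (\<real>\<^sub>\<le>\<^sub>0 - {0}) z * pi) \<in> borel_measurable borel"
    by (rule borel_measurable_add)
  also have "(\<lambda>z. indicator (- \<real>\<^sub>\<le>\<^sub>0) z *\<^sub>R Arg z + indicator (\<real>\<^sub>\<le>\<^sub>0 - {0}) z * pi) = Arg"
    by (auto simp: fun_eq_iff indicator_def complex_nonpos_Reals_iff Arg_real complex_is_Real_iff
        complex_eq_iff)
  finally show ?thesis .
qed

lemma cis_Arg_circle: "z \<in> unit_circle \<Longrightarrow> cis (Arg z) = z"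
  using cis_Arg[of z] by (cases "z = 0") (auto simp: sgn_div_norm)

text \<open>The argument is cut into steps of length \<open>1 / Suc m\<close>. The arc is named by
  an integer so that kernels can be made to depend on a discrete parameter.\<close>

definition arc_index :: "nat \<Rightarrow> complex \<Rightarrow> int" where
  "arc_index m z = \<lfloor>Arg z * real (Suc m)\<rfloor>"

definition arc_point :: "nat \<Rightarrow> int \<Rightarrow> complex" where
  "arc_point m i = cis (of_int i / real (Suc m))"

lemma dist_arc_point:
  assumes "z \<in> unit_circle"
  shows "dist z (arc_point m (arc_index m z)) \<le> 1 / real (Suc m)"
proof -
  define x where "x = Arg z * real (Suc m)"
  have "dist z (arc_point m (arc_index m z)) = dist (cis (Arg z)) (arc_point m (arc_index m z))"
    using assms by (simp add: cis_Arg_circle)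
  also have "\<dots> \<le> \<bar>Arg z - of_int \<lfloor>x\<rfloor> / real (Suc m)\<bar>"
    unfolding arc_point_def arc_index_def x_def by (rule dist_cis_le)
  also have "Arg z = x / real (Suc m)"
    by (simp add: x_def)
  also have "\<bar>x / real (Suc m) - of_int \<lfloor>x\<rfloor> / real (Suc m)\<bar> = \<bar>x - of_int \<lfloor>x\<rfloor>\<bar> / real (Suc m)"
    by (simp add: diff_divide_distrib[symmetric])
  also have "\<dots> \<le> 1 / real (Suc m)"
    by (intro divide_right_mono) linarith+
  finally show ?thesis .
qed

lemma measurable_arc_index:
  assumes "\<mu> \<in> circle_prob"
  shows "arc_index m \<in> \<mu> \<rightarrow>\<^sub>M count_space UNIV"
proof -
  have "arc_index m \<in> circle_borel \<rightarrow>\<^sub>M count_space UNIV"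
    unfolding arc_index_def by (rule measurable_restrict_space1) measurable
  then show ?thesis
    by (simp add: measurable_cong_sets[OF circle_probD(2)[OF assms] refl])
qed

text \<open>The measure attached to \<open>z\<close> is the one chosen for the representative of its
  arc, not for \<open>z\<close> itself, so that no measurable dependence of \<open>\<nu>\<close> on
  the point has to be arranged.\<close>

definition arc_mixture :: "(nat \<Rightarrow> complex \<Rightarrow> complex measure) \<Rightarrow> complex measure \<Rightarrow> nat \<Rightarrow> complex measure" where
  "arc_mixture \<nu> \<mu> m = bind \<mu> (\<lambda>z. \<nu> m (arc_point m (arc_index m z)))"

lemma
  assumes "\<mu> \<in> circle_prob" "\<And>m w. w \<in> unit_circle \<Longrightarrow> \<nu> m w \<in> circle_prob"
  shows measurable_arc_mixture:
      "(\<lambda>z. \<nu> m (arc_point m (arc_index m z))) \<in> \<mu> \<rightarrow>\<^sub>M subprob_algebra circle_borel"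
    and arc_mixture_circle_prob: "arc_mixture \<nu> \<mu> m \<in> circle_prob"
proof -
  show *: "(\<lambda>z. \<nu> m (arc_point m (arc_index m z))) \<in> \<mu> \<rightarrow>\<^sub>M subprob_algebra circle_borel"
    by (rule measurable_subprob_algebra_via_countable[OF measurable_arc_index[OF assms(1)]])
       (auto intro: assms simp: arc_point_def)
  show "arc_mixture \<nu> \<mu> m \<in> circle_prob"
    unfolding arc_mixture_def
    by (rule bind_circle_prob[OF circle_probD(1)[OF assms(1)] *]) (auto intro: assms simp: arc_point_def)
qed

text \<open>The mixture moves mass over distances of at most \<open>2 / Suc m\<close>, which changes
  the integral of a uniformly continuous function arbitrarily little.\<close>

lemma limitin_arc_mixture:
  assumes \<mu>: "\<mu> \<in> circle_prob"
    and \<nu>: "\<And>m w. w \<in> unit_circle \<Longrightarrow> \<nu> m w \<in> circle_prob"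
    and near: "\<And>m w. w \<in> unit_circle \<Longrightarrow> AE z in \<nu> m w. dist z w \<le> 1 / real (Suc m)"
  shows "limitin weak_topology (arc_mixture \<nu> \<mu>) \<mu> sequentially"
  unfolding limitin_weak_topology
proof (intro conjI allI impI)
  show "\<mu> \<in> circle_prob" "\<forall>\<^sub>F m in sequentially. arc_mixture \<nu> \<mu> m \<in> circle_prob"
    using arc_mixture_circle_prob[OF \<mu> \<nu>] \<mu> by auto
  fix f :: "complex \<Rightarrow> real" assume f: "continuous_on unit_circle f"
  interpret prob_space \<mu> using \<mu> by (simp add: circle_probD)
  show "(\<lambda>m. \<integral>z. f z \<partial>arc_mixture \<nu> \<mu> m) \<longlonglongrightarrow> (\<integral>z. f z \<partial>\<mu>)"
  proof (rule LIMSEQ_I)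
    fix e :: real assume "e > 0"
    have "uniformly_continuous_on unit_circle f"
      using f by (intro compact_uniformly_continuous) auto
    then obtain d where d: "d > 0"
      and fd: "\<And>x y. x \<in> unit_circle \<Longrightarrow> y \<in> unit_circle \<Longrightarrow> dist y x < d \<Longrightarrow> dist (f y) (f x) < e / 2"
      unfolding uniformly_continuous_on_def using \<open>e > 0\<close> by (metis half_gt_zero)
    \<comment> \<open>Two displacements of at most \<open>1 / Suc m\<close> add up, from
      \<open>z\<close> to its representative and from there to \<open>x\<close>; hence
      \<open>d / 2\<close>.\<close>
    obtain m0 where m0: "1 / real (Suc m0) < d / 2"
      using nat_approx_posE[of "d / 2"] d by auto
    have "norm ((\<integral>z. f z \<partial>arc_mixture \<nu> \<mu> m) - (\<integral>z. f z \<partial>\<mu>)) < e" if "m \<ge> m0" for m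
    proof -
      have m: "1 / real (Suc m) < d / 2"
        using m0 that by (smt (verit) frac_le of_nat_0_less_iff of_nat_mono zero_less_Suc Suc_le_mono)
      define \<kappa> where "\<kappa> z = \<nu> m (arc_point m (arc_index m z))" for z
      have \<kappa>P: "\<kappa> z \<in> circle_prob" for z
        unfolding \<kappa>_def by (rule \<nu>) (simp add: arc_point_def)
      have \<kappa>: "\<kappa> \<in> \<mu> \<rightarrow>\<^sub>M subprob_algebra circle_borel"
        unfolding \<kappa>_def by (rule measurable_arc_mixture[OF \<mu> \<nu>])
      obtain B where B: "\<And>z. z \<in> unit_circle \<Longrightarrow> norm (f z) \<le> B"
        using continuous_on_circle_bounded[OF f] by metis
      have pointwise: "\<bar>(\<integral>x. f x \<partial>\<kappa> z) - f z\<bar> \<le> e / 2" if z: "z \<in> unit_circle" for z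
      proof -
        interpret \<kappa>: prob_space "\<kappa> z" using \<kappa>P by (simp add: circle_probD)
        have "(\<integral>x. f x \<partial>\<kappa> z) - f z = (\<integral>x. f x - f z \<partial>\<kappa> z)"
          using integrable_circle_prob[OF \<kappa>P f] by (simp add: \<kappa>.prob_space)
        also have "\<bar>\<dots>\<bar> \<le> (\<integral>x. \<bar>f x - f z\<bar> \<partial>\<kappa> z)"
          by (rule integral_abs_bound)
        also have "\<dots> \<le> (\<integral>x. e / 2 \<partial>\<kappa> z)"
        proof (rule integral_mono_AE)
          show "integrable (\<kappa> z) (\<lambda>x. \<bar>f x - f z\<bar>)"
            using integrable_circle_prob[OF \<kappa>P f] by auto
          have "AE x in \<kappa> z. dist x (arc_point m (arc_index m z)) \<le> 1 / real (Suc m)"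
            unfolding \<kappa>_def by (rule near) (simp add: arc_point_def)
          moreover have "AE x in \<kappa> z. x \<in> unit_circle"
            using circle_probD(3)[OF \<kappa>P] by (intro AE_I2) auto
          ultimately show "AE x in \<kappa> z. \<bar>f x - f z\<bar> \<le> e / 2"
          proof eventually_elim
            case (elim x)
            have "dist x z < d"
              using elim dist_arc_point[OF z, of m] m
                dist_triangle2[of x z "arc_point m (arc_index m z)"] by linarith
            then show ?case
              using fd[OF z, of x] elim by (simp add: dist_real_def)
          qed
        qed simp
        finally show ?thesis by (simp add: \<kappa>.prob_space)
      qed
      have int: "integrable \<mu> (\<lambda>z. \<integral>x. f x \<partial>\<kappa> z)"
      proof (rule integrable_const_bound[of _ "B + e / 2"])
        show "(\<lambda>z. \<integral>x. f x \<partial>\<kappa> z) \<in> borel_measurable \<mu>"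
          by (rule measurable_compose[OF \<kappa> integral_measurable_subprob_algebra])
             (rule continuous_on_circle_measurable[OF f])
        show "AE z in \<mu>. norm (\<integral>x. f x \<partial>\<kappa> z) \<le> B + e / 2"
        proof (rule AE_I2)
          fix z assume "z \<in> space \<mu>"
          then have "z \<in> unit_circle" by (simp add: circle_probD(3)[OF \<mu>])
          from pointwise[OF this] B[OF this] show "norm (\<integral>x. f x \<partial>\<kappa> z) \<le> B + e / 2"
            unfolding real_norm_def by linarith
        qed
      qed
      have "(\<integral>z. f z \<partial>arc_mixture \<nu> \<mu> m) - (\<integral>z. f z \<partial>\<mu>) = (\<integral>z. (\<integral>x. f x \<partial>\<kappa> z) - f z \<partial>\<mu>)"
        unfolding arc_mixture_def \<kappa>_def[symmetric]
        using integral_bind_circle[OF prob_space_axioms \<kappa> \<kappa>P f] int integrable_circle_prob[OF \<mu> f]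
        by simp
      also have "norm \<dots> \<le> (\<integral>z. norm ((\<integral>x. f x \<partial>\<kappa> z) - f z) \<partial>\<mu>)"
        by (rule integral_norm_bound)
      also have "\<dots> \<le> (\<integral>z. e / 2 \<partial>\<mu>)"
        using int integrable_circle_prob[OF \<mu> f] pointwise
        by (intro integral_mono) (auto simp: circle_probD(3)[OF \<mu>])
      also have "\<dots> < e"
        using \<open>e > 0\<close> by (simp add: prob_space)
      finally show ?thesis .
    qed
    then show "\<exists>m0. \<forall>m\<ge>m0. norm ((\<integral>z. f z \<partial>arc_mixture \<nu> \<mu> m) - (\<integral>z. f z \<partial>\<mu>)) < e"
      by blast
  qed
qed

section \<open>Measures along which the sequence is rigid\<close>

definition rigid_measure :: "(nat \<Rightarrow> int) \<Rightarrow> complex measure \<Rightarrow> bool" where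
  "rigid_measure n \<mu> \<longleftrightarrow> \<mu> \<in> circle_prob \<and> (\<lambda>k. fourier_coeff \<mu> (n k)) \<longlonglongrightarrow> 1"

text \<open>Half the squared L2 distance between \<open>z powi m\<close> and 1. The integrand is
  nonnegative on the circle, so that defects of different measures can be compared by
  monotonicity.\<close>

definition defect :: "complex measure \<Rightarrow> int \<Rightarrow> real" where
  "defect \<mu> m = (\<integral>z. 1 - Re (z powi m) \<partial>\<mu>)"

lemma defect_eq:
  assumes "\<mu> \<in> circle_prob"
  shows "defect \<mu> m = 1 - Re (fourier_coeff \<mu> m)"
proof -
  interpret prob_space \<mu> using assms by (simp add: circle_probD)
  have "integrable \<mu> (\<lambda>z. Re (z powi m))"
    by (intro integrable_circle_prob[OF assms] continuous_intros) auto
  then show ?thesis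
    by (simp add: defect_def Re_Im_fourier_coeff[OF assms] prob_space)
qed

lemma Re_powi_le_1: "z \<in> unit_circle \<Longrightarrow> Re (z powi m) \<le> 1"
  using complex_Re_le_cmod[of "z powi m"] by (simp add: norm_power_int)

lemma defect_nonneg:
  assumes "\<mu> \<in> circle_prob"
  shows "defect \<mu> m \<ge> 0"
  unfolding defect_def
  by (rule Bochner_Integration.integral_nonneg_AE, rule AE_I2) (use Re_powi_le_1 in \<open>auto simp: circle_probD(3)[OF assms]\<close>)

text \<open>Expand the square of \<open>cmod (w - 1)\<close> and use
  \<open>cmod w \<le> 1\<close>.\<close>

lemma cmod_one_minus_fourier_coeff_le:
  assumes "\<mu> \<in> circle_prob"
  shows "(cmod (fourier_coeff \<mu> m - 1))\<^sup>2 \<le> 2 * defect \<mu> m"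
proof -
  define w where "w = fourier_coeff \<mu> m"
  have "(cmod (w - 1))\<^sup>2 = (cmod w)\<^sup>2 + 1 - 2 * Re w"
    by (simp only: cmod_power2) (simp add: power2_eq_square algebra_simps)
  moreover have "(cmod w)\<^sup>2 \<le> 1"
    using cmod_fourier_coeff_le[OF assms] by (simp add: w_def power_le_one)
  ultimately show ?thesis
    by (simp add: defect_eq[OF assms] w_def)
qed

lemma rigid_measure_iff_defect:
  "rigid_measure n \<mu> \<longleftrightarrow> \<mu> \<in> circle_prob \<and> (\<lambda>k. defect \<mu> (n k)) \<longlonglongrightarrow> 0"
proof (cases "\<mu> \<in> circle_prob")
  case True
  have "(\<lambda>k. fourier_coeff \<mu> (n k)) \<longlonglongrightarrow> 1" if "(\<lambda>k. defect \<mu> (n k)) \<longlonglongrightarrow> 0"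
  proof -
    have "(\<lambda>k. sqrt (2 * defect \<mu> (n k))) \<longlonglongrightarrow> sqrt (2 * 0)"
      by (intro tendsto_intros that)
    then have "(\<lambda>k. fourier_coeff \<mu> (n k) - 1) \<longlonglongrightarrow> 0"
      by - (rule Lim_null_comparison[where g="\<lambda>k. sqrt (2 * defect \<mu> (n k))"],
            auto intro!: always_eventually real_le_rsqrt cmod_one_minus_fourier_coeff_le[OF True])
    then show ?thesis
      by (simp add: LIM_zero_iff)
  qed
  moreover have "(\<lambda>k. defect \<mu> (n k)) \<longlonglongrightarrow> 0" if "(\<lambda>k. fourier_coeff \<mu> (n k)) \<longlonglongrightarrow> 1"
  proof -
    have "(\<lambda>k. 1 - Re (fourier_coeff \<mu> (n k))) \<longlonglongrightarrow> 1 - Re 1"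
      by (intro tendsto_intros that)
    then show ?thesis by (simp add: defect_eq[OF True])
  qed
  ultimately show ?thesis
    by (auto simp: rigid_measure_def)
qed (simp add: rigid_measure_def)

text \<open>Conditioning on \<open>A\<close> multiplies the integral of a nonnegative function by at
  most \<open>1 / measure \<mu> A\<close>, a factor that does not depend on the frequency.\<close>

lemma rigid_measure_uniform_measure:
  assumes \<mu>: "rigid_measure n \<mu>" and A: "emeasure \<mu> A \<noteq> 0"
  shows "rigid_measure n (uniform_measure \<mu> A)"
proof -
  have P: "\<mu> \<in> circle_prob" and lim: "(\<lambda>k. defect \<mu> (n k)) \<longlonglongrightarrow> 0"
    using \<mu> by (auto simp: rigid_measure_iff_defect)
  interpret prob_space \<mu> using P by (simp add: circle_probD)
  have P': "uniform_measure \<mu> A \<in> circle_prob"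
    using P A prob_space_uniform_measure[of \<mu> A] by (simp add: circle_prob_def)
  have A_sets: "A \<in> sets \<mu>"
    using A emeasure_notin_sets by blast
  have mA: "measure \<mu> A > 0"
    using A by (simp add: emeasure_eq_measure zero_less_measure_iff)
  have cont: "continuous_on unit_circle (\<lambda>z::complex. 1 - Re (z powi m))" for m
    by (intro continuous_intros) auto
  have "defect (uniform_measure \<mu> A) m \<le> defect \<mu> m / measure \<mu> A" for m
  proof -
    have "ennreal (defect (uniform_measure \<mu> A) m) = (\<integral>\<^sup>+z. ennreal (1 - Re (z powi m)) \<partial>uniform_measure \<mu> A)"
      unfolding defect_def using P' P Re_powi_le_1
      by (intro nn_integral_eq_integral[symmetric] integrable_circle_prob cont AE_I2)
         (auto simp: circle_probD(3))
    also have "\<dots> = (\<integral>\<^sup>+z. ennreal (1 - Re (z powi m)) * indicator A z \<partial>\<mu>) / emeasure \<mu> A"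
      using borel_measurable_circle_prob[OF P cont] A_sets
      by (intro nn_integral_uniform_measure) auto
    also have "\<dots> \<le> (\<integral>\<^sup>+z. ennreal (1 - Re (z powi m)) \<partial>\<mu>) / emeasure \<mu> A"
      by (intro divide_right_mono_ennreal nn_integral_mono) (auto split: split_indicator)
    also have "(\<integral>\<^sup>+z. ennreal (1 - Re (z powi m)) \<partial>\<mu>) = ennreal (defect \<mu> m)"
      unfolding defect_def using P Re_powi_le_1
      by (intro nn_integral_eq_integral integrable_circle_prob cont AE_I2)
         (auto simp: circle_probD(3))
    also have "ennreal (defect \<mu> m) / emeasure \<mu> A = ennreal (defect \<mu> m / measure \<mu> A)"
      using mA defect_nonneg[OF P] by (simp add: emeasure_eq_measure divide_ennreal)
    finally show ?thesis
      using mA defect_nonneg[OF P] by (simp add: ennreal_le_iff)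
  qed
  moreover have "(\<lambda>k. defect \<mu> (n k) / measure \<mu> A) \<longlonglongrightarrow> 0 / measure \<mu> A"
    using lim mA by (intro tendsto_intros) auto
  ultimately have "(\<lambda>k. defect (uniform_measure \<mu> A) (n k)) \<longlonglongrightarrow> 0"
    using defect_nonneg[OF P']
    by - (rule Lim_null_comparison[of _ "\<lambda>k. defect \<mu> (n k) / measure \<mu> A"], auto)
  with P' show ?thesis by (simp add: rigid_measure_iff_defect)
qed

lemma measurable_circle_power [measurable]: "(\<lambda>z. z ^ m) \<in> circle_borel \<rightarrow>\<^sub>M circle_borel"
  by (rule measurable_restrict_space3) (auto simp: norm_power)

lemma one_minus_Re_circle:
  assumes "z \<in> unit_circle"
  shows "1 - Re z = (cmod (1 - z))\<^sup>2 / 2"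
proof -
  have "(Re z)\<^sup>2 + (Im z)\<^sup>2 = 1"
    using assms by (simp flip: cmod_power2)
  then show ?thesis
    unfolding cmod_power2 by (simp add: power2_eq_square algebra_simps)
qed

text \<open>On the circle \<open>cmod (1 - u ^ m) \<le> m * cmod (1 - u)\<close>. With
  \<open>u = z powi j\<close> this bounds the new defect by \<open>m\<^sup>2\<close> times the old
  one, for all frequencies \<open>j\<close> alike.\<close>

lemma rigid_measure_power:
  assumes \<mu>: "rigid_measure n \<mu>"
  shows "rigid_measure n (distr \<mu> circle_borel (\<lambda>z. z ^ m))"
proof -
  have P: "\<mu> \<in> circle_prob" and lim: "(\<lambda>k. defect \<mu> (n k)) \<longlonglongrightarrow> 0"
    using \<mu> by (auto simp: rigid_measure_iff_defect)
  have meas: "(\<lambda>z. z ^ m) \<in> \<mu> \<rightarrow>\<^sub>M circle_borel"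
    by (simp add: measurable_cong_sets[OF circle_probD(2)[OF P] refl])
  let ?\<nu> = "distr \<mu> circle_borel (\<lambda>z. z ^ m)"
  have P': "?\<nu> \<in> circle_prob"
    by (rule distr_circle_prob[OF circle_probD(1)[OF P] meas])
  have "defect ?\<nu> j \<le> (real m)\<^sup>2 * defect \<mu> j" for j
  proof -
    have "defect ?\<nu> j = (\<integral>z. 1 - Re ((z ^ m) powi j) \<partial>\<mu>)"
      unfolding defect_def by (intro integral_distr_circle[OF meas] continuous_intros) auto
    also have "\<dots> \<le> (\<integral>z. (real m)\<^sup>2 * (1 - Re (z powi j)) \<partial>\<mu>)"
    proof (rule integral_mono)
      show "integrable \<mu> (\<lambda>z. 1 - Re ((z ^ m) powi j))"
        "integrable \<mu> (\<lambda>z. (real m)\<^sup>2 * (1 - Re (z powi j)))"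
        by (intro integrable_circle_prob[OF P] continuous_intros; auto)+
      fix z assume "z \<in> space \<mu>"
      then have z: "z \<in> unit_circle" by (simp add: circle_probD(3)[OF P])
      have "(z ^ m) powi j = (z powi j) ^ m"
        by (metis power_int_mult power_int_of_nat mult.commute)
      moreover have "cmod (1 - (z powi j) ^ m) \<le> real m * cmod (1 - z powi j)"
        using norm_power_diff[of 1 "z powi j" m] z by (simp add: norm_power_int)
      then have "(cmod (1 - (z powi j) ^ m))\<^sup>2 \<le> (real m)\<^sup>2 * (cmod (1 - z powi j))\<^sup>2"
        by (metis norm_ge_zero power_mono power_mult_distrib)
      ultimately show "1 - Re ((z ^ m) powi j) \<le> (real m)\<^sup>2 * (1 - Re (z powi j))"
        using z by (simp add: one_minus_Re_circle norm_power_int norm_power)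
    qed
    also have "\<dots> = (real m)\<^sup>2 * defect \<mu> j"
      by (simp add: defect_def)
    finally show ?thesis .
  qed
  moreover have "(\<lambda>k. (real m)\<^sup>2 * defect \<mu> (n k)) \<longlonglongrightarrow> (real m)\<^sup>2 * 0"
    by (intro tendsto_intros lim)
  ultimately have "(\<lambda>k. defect ?\<nu> (n k)) \<longlonglongrightarrow> 0"
    using defect_nonneg[OF P']
    by - (rule Lim_null_comparison[of _ "\<lambda>k. (real m)\<^sup>2 * defect \<mu> (n k)"], auto)
  with P' show ?thesis by (simp add: rigid_measure_iff_defect)
qed

text \<open>The rotation number \<open>\<theta>\<close> is irrational, since a denominator
  \<open>b\<close> would give \<open>w ^ b = 1\<close>. Multiples of an irrational number are dense
  modulo 1 (Kronecker).\<close>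

lemma dense_powers_non_root_of_unity:
  assumes w: "w \<in> unit_circle" "\<And>m. m > 0 \<Longrightarrow> w ^ m \<noteq> 1" and z: "z \<in> unit_circle" and "e > 0"
  obtains m where "dist (w ^ m) z < e"
proof -
  define \<theta> \<alpha> where "\<theta> = Arg w / (2 * pi)" and "\<alpha> = Arg z / (2 * pi)"
  have w_eq: "w = cis (2 * pi * \<theta>)" and z_eq: "z = cis (2 * pi * \<alpha>)"
    using w z by (simp_all add: \<theta>_def \<alpha>_def cis_Arg_circle)
  have "\<theta> \<notin> \<rat>"
  proof
    assume "\<theta> \<in> \<rat>"
    then obtain a b where ab: "b > 0" "\<theta> = of_int a / of_int b"
      by (meson Rats_cases')
    have "real (nat b) * (2 * pi * \<theta>) = 2 * pi * of_int a"
      using ab by simp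
    then have "w ^ nat b = cis (2 * pi * of_int a)"
      by (simp only: w_eq Complex.DeMoivre)
    also have "\<dots> = 1"
      by (rule cis_multiple_2pi) simp
    finally show False using w(2)[of "nat b"] ab by simp
  qed
  \<comment> \<open>The scale is \<open>e / (2 * pi)\<close> because \<open>cis (2 * pi * t)\<close>
    moves by at most \<open>2 * pi\<close> times the change of \<open>t\<close>.\<close>
  then obtain h k where k: "k > 0" "\<bar>of_int k * \<theta> - of_int h - \<alpha>\<bar> < e / (2 * pi)"
    by (rule sequence_of_fractional_parts_is_dense[of \<theta> "e / (2 * pi)" \<alpha>]) (use \<open>e > 0\<close> in auto)
  have "real (nat k) * (2 * pi * \<theta>) = 2 * pi * (of_int k * \<theta>)"
    using k by simp
  then have "w ^ nat k = cis (2 * pi * (of_int k * \<theta>)) * cis (2 * pi * (- of_int h))"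
    using cis_multiple_2pi[of "- of_int h"] by (simp only: w_eq Complex.DeMoivre) simp
  also have "\<dots> = cis (2 * pi * (of_int k * \<theta> - of_int h))"
    by (simp add: cis_mult algebra_simps)
  finally have "dist (w ^ nat k) z \<le> \<bar>2 * pi * (of_int k * \<theta> - of_int h) - 2 * pi * \<alpha>\<bar>"
    unfolding z_eq by (metis dist_cis_le)
  also have "\<dots> = 2 * pi * \<bar>of_int k * \<theta> - of_int h - \<alpha>\<bar>"
    by (simp add: abs_mult flip: right_diff_distrib)
  also have "\<dots> < e"
    using k by (simp add: field_simps)
  finally show ?thesis using that by blast
qed

text \<open>Otherwise open sets of measure 0 would cover \<open>B\<close>. By the Lindelof property
  countably many of them suffice, and \<open>B\<close> would be null.\<close>

lemma support_point:
  assumes \<mu>: "\<mu> \<in> circle_prob" and B: "emeasure \<mu> B \<noteq> 0"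
  obtains w where "w \<in> B" "\<And>U. open U \<Longrightarrow> w \<in> U \<Longrightarrow> emeasure \<mu> (U \<inter> unit_circle) \<noteq> 0"
proof -
  have "\<exists>w\<in>B. \<forall>U. open U \<longrightarrow> w \<in> U \<longrightarrow> emeasure \<mu> (U \<inter> unit_circle) \<noteq> 0"
  proof (rule ccontr)
    assume "\<not> ?thesis"
    then have cover: "\<And>w. w \<in> B \<Longrightarrow> \<exists>U. open U \<and> w \<in> U \<and> emeasure \<mu> (U \<inter> unit_circle) = 0"
      by blast
    define \<F> where "\<F> = {U. open U \<and> emeasure \<mu> (U \<inter> unit_circle) = 0}"
    obtain \<F>' where \<F>': "\<F>' \<subseteq> \<F>" "countable \<F>'" "\<Union>\<F>' = \<Union>\<F>"
      using Lindelof[of \<F>] by (auto simp: \<F>_def)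
    have B_sets: "B \<in> sets \<mu>"
      using B emeasure_notin_sets by blast
    have "(\<Union>U\<in>\<F>'. U \<inter> unit_circle) \<in> null_sets \<mu>"
    proof (rule null_sets_UN')
      fix U assume "U \<in> \<F>'"
      then have "U \<in> \<F>" using \<F>' by blast
      then show "U \<inter> unit_circle \<in> null_sets \<mu>"
        unfolding \<F>_def
        by (intro null_setsI) (auto simp: circle_probD(2)[OF \<mu>] intro!: circle_borel_setsI)
    qed (rule \<F>')
    moreover have "B \<subseteq> (\<Union>U\<in>\<F>'. U \<inter> unit_circle)"
    proof
      fix w assume "w \<in> B"
      then have "w \<in> \<Union>\<F>'" "w \<in> unit_circle"
        using cover[of w] \<F>' sets.sets_into_space[OF B_sets] circle_probD(3)[OF \<mu>]
        by (auto simp: \<F>_def)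
      then show "w \<in> (\<Union>U\<in>\<F>'. U \<inter> unit_circle)" by blast
    qed
    ultimately have "B \<in> null_sets \<mu>"
      using B_sets null_sets_subset by blast
    with B show False by blast
  qed
  then show ?thesis using that by blast
qed

lemma rigid_measure_localised:
  assumes rig: "rigidity_sequence n" and z: "z \<in> unit_circle" and "e > 0"
  obtains \<nu> where "rigid_measure n \<nu>" "AE x in \<nu>. dist x z < e"
proof -
  obtain \<mu> where \<mu>: "rigid_measure n \<mu>" and c: "\<And>z. z \<in> unit_circle \<Longrightarrow> emeasure \<mu> {z} = 0"
    using rig by (auto simp: rigidity_sequence_def rigid_measure_def circle_prob_cont_def)
  then have P: "\<mu> \<in> circle_prob" by (simp add: rigid_measure_def)
  interpret prob_space \<mu> using P by (simp add: circle_probD)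
  \<comment> \<open>The roots of unity: a countable set, hence null because \<open>\<mu>\<close> has
    no atoms. Some support point of \<open>\<mu>\<close> therefore lies outside it and has dense
    powers.\<close>
  define R where "R = (\<Union>m\<in>{0<..}. {w \<in> unit_circle. w ^ m = 1})"
  have "R \<in> null_sets \<mu>"
  proof -
    have "countable R"
      unfolding R_def
      by (rule countable_UN) (auto intro!: countable_finite intro: finite_subset[OF _ finite_nth_roots[of _ 1]])
    moreover have "R \<subseteq> unit_circle" by (auto simp: R_def)
    ultimately have "(\<Union>w\<in>R. {w}) \<in> null_sets \<mu>"
      using c by (intro null_sets_UN') 
        (auto simp: circle_probD(2)[OF P] intro!: null_setsI circle_borel_setsI)
    then show ?thesis by simp
  qed
  then have "emeasure \<mu> (unit_circle - R) = emeasure \<mu> unit_circle"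
    using circle_probD(3)[OF P] sets.top[of \<mu>] by (intro emeasure_Diff_null_set) auto
  then have "emeasure \<mu> (unit_circle - R) \<noteq> 0"
    using emeasure_space_1 circle_probD(3)[OF P] by simp
  then obtain w where w: "w \<in> unit_circle - R"
    and supp: "\<And>U. open U \<Longrightarrow> w \<in> U \<Longrightarrow> emeasure \<mu> (U \<inter> unit_circle) \<noteq> 0"
    using support_point[OF P] by metis
  have "w ^ m \<noteq> 1" if "m > 0" for m
    using w that by (auto simp: R_def)
  then obtain m where m: "dist (w ^ m) z < e"
    using dense_powers_non_root_of_unity[of w z e] w z \<open>e > 0\<close> by blast
  \<comment> \<open>The preimage of the ball around \<open>z\<close> under the power map. It is open
    and contains the support point \<open>w\<close>, so \<open>\<mu>\<close> charges it, and the
    power map sends it to within \<open>e\<close> of \<open>z\<close>.\<close>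
  define U where "U = {x::complex. dist (x ^ m) z < e}"
  have "open U"
    unfolding U_def by (intro open_Collect_less continuous_intros)
  define \<nu> where "\<nu> = uniform_measure \<mu> (U \<inter> unit_circle)"
  have pos: "emeasure \<mu> (U \<inter> unit_circle) \<noteq> 0"
    using supp[OF \<open>open U\<close>] m by (simp add: U_def)
  then have \<nu>: "rigid_measure n \<nu>"
    unfolding \<nu>_def by (rule rigid_measure_uniform_measure[OF \<mu>])
  have \<nu>P: "\<nu> \<in> circle_prob"
    using \<nu> by (simp add: rigid_measure_def)
  have meas: "(\<lambda>z. z ^ m) \<in> \<nu> \<rightarrow>\<^sub>M circle_borel"
    by (simp add: measurable_cong_sets[OF circle_probD(2)[OF \<nu>P] refl])
  have "AE x in \<nu>. dist (x ^ m) z < e"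
    unfolding \<nu>_def using pos emeasure_neq_0_sets[OF pos]
    by (intro AE_uniform_measureI AE_I2) (auto simp: U_def)
  then have "AE x in distr \<nu> circle_borel (\<lambda>z. z ^ m). dist x z < e"
  proof (subst AE_distr_iff[OF meas])
    have "{x \<in> space circle_borel. dist x z < e} = ball z e \<inter> unit_circle"
      by (auto simp: space_restrict_space dist_commute)
    then show "{x \<in> space circle_borel. dist x z < e} \<in> sets circle_borel"
      by (auto intro!: circle_borel_setsI)
  qed
  then show ?thesis
    using that rigid_measure_power[OF \<nu>] by blast
qed

text \<open>The defect of a mixture is the mean of the defects. These tend to 0 pointwise and are at
  most 2, so that dominated convergence applies.\<close>

lemma rigid_measure_bind:
  assumes M: "prob_space M" and N: "N \<in> M \<rightarrow>\<^sub>M subprob_algebra circle_borel"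
    and R: "\<And>x. x \<in> space M \<Longrightarrow> rigid_measure n (N x)"
  shows "rigid_measure n (bind M N)"
proof -
  interpret prob_space M by fact
  have P: "\<And>x. x \<in> space M \<Longrightarrow> N x \<in> circle_prob"
    using R by (auto simp: rigid_measure_def)
  have P': "bind M N \<in> circle_prob"
    using M N P by (rule bind_circle_prob)
  have cont: "continuous_on unit_circle (\<lambda>z::complex. 1 - Re (z powi m))" for m
    by (intro continuous_intros) auto
  have "(\<lambda>k. \<integral>x. defect (N x) (n k) \<partial>M) \<longlonglongrightarrow> (\<integral>x. 0 \<partial>M)"
  proof (rule integral_dominated_convergence[where w="\<lambda>_. 2"])
    show "(\<lambda>x. defect (N x) (n k)) \<in> borel_measurable M" for k
      unfolding defect_def
      by (rule measurable_compose[OF N integral_measurable_subprob_algebra])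
         (rule continuous_on_circle_measurable[OF cont])
    show "AE x in M. (\<lambda>k. defect (N x) (n k)) \<longlonglongrightarrow> 0"
      using R by (auto simp: rigid_measure_iff_defect)
    show "AE x in M. norm (defect (N x) (n k)) \<le> 2" for k
    proof (rule AE_I2)
      fix x assume "x \<in> space M"
      note Px = P[OF this]
      show "norm (defect (N x) (n k)) \<le> 2"
        using cmod_fourier_coeff_le[OF Px, of "n k"] abs_Re_le_cmod[of "fourier_coeff (N x) (n k)"]
        unfolding defect_eq[OF Px] by (simp add: abs_le_iff)
    qed
  qed auto
  then have "(\<lambda>k. defect (bind M N) (n k)) \<longlonglongrightarrow> 0"
    unfolding defect_def using integral_bind_circle[OF M N P cont] by simp
  with P' show ?thesis by (simp add: rigid_measure_iff_defect)
qed

section \<open>Density from rigidity\<close>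

lemma rigid_measure_in_rigidity_set:
  assumes "rigid_measure n \<mu>" "\<epsilon> > 0"
  shows "\<mu> \<in> rigidity_set n \<epsilon>"
proof -
  have "(\<lambda>k. ereal (cmod (fourier_coeff \<mu> (n k) - 1))) \<longlonglongrightarrow> ereal (cmod (1 - 1))"
    using assms
    by (intro tendsto_ereal tendsto_norm tendsto_diff tendsto_const) (simp add: rigid_measure_def)
  then have "limsup (\<lambda>k. ereal (cmod (fourier_coeff \<mu> (n k) - 1))) = 0"
    by (subst lim_imp_Limsup[OF sequentially_bot]) (simp_all add: zero_ereal_def)
  then show ?thesis
    using assms by (simp add: rigidity_set_def rigid_measure_def)
qed

text \<open>Rigid measures localised at scale \<open>1 / Suc m\<close> are mixed according to
  \<open>\<mu>\<close>. The mixtures stay rigid, so they lie in every rigidity set, and they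
  converge weakly to \<open>\<mu>\<close>.\<close>

lemma rigidity_sequence_imp_dense:
  assumes rig: "rigidity_sequence n" and "\<epsilon> > 0"
  shows "weak_topology closure_of (rigidity_set n \<epsilon>) = circle_prob"
proof
  show "weak_topology closure_of (rigidity_set n \<epsilon>) \<subseteq> circle_prob"
    using closure_of_subset_topspace[of weak_topology] by simp
  have "\<forall>m w. \<exists>\<nu>. w \<in> unit_circle \<longrightarrow> rigid_measure n \<nu> \<and> (AE x in \<nu>. dist x w < 1 / real (Suc m))"
  proof (intro allI)
    fix m :: nat and w :: complex
    have "1 / real (Suc m) > 0" by simp
    then show "\<exists>\<nu>. w \<in> unit_circle \<longrightarrow> rigid_measure n \<nu> \<and> (AE x in \<nu>. dist x w < 1 / real (Suc m))"
      using rigid_measure_localised[OF rig, of w "1 / real (Suc m)"] by blast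
  qed
  then obtain \<nu> where \<nu>: "\<And>m w. w \<in> unit_circle \<Longrightarrow> rigid_measure n (\<nu> m w)"
      "\<And>m w. w \<in> unit_circle \<Longrightarrow> AE x in \<nu> m w. dist x w < 1 / real (Suc m)"
    by metis
  have \<nu>P: "\<nu> m w \<in> circle_prob" if "w \<in> unit_circle" for m w
    using \<nu>(1)[OF that] by (simp add: rigid_measure_def)
  show "circle_prob \<subseteq> weak_topology closure_of (rigidity_set n \<epsilon>)"
  proof
    fix \<mu> assume \<mu>: "\<mu> \<in> circle_prob"
    have "limitin weak_topology (arc_mixture \<nu> \<mu>) \<mu> sequentially"
    proof (rule limitin_arc_mixture[OF \<mu> \<nu>P])
      show "AE x in \<nu> m w. dist x w \<le> 1 / real (Suc m)" if "w \<in> unit_circle" for m w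
        using \<nu>(2)[OF that, of m] by eventually_elim simp
    qed
    moreover have "rigid_measure n (arc_mixture \<nu> \<mu> m)" for m
      unfolding arc_mixture_def
      by (rule rigid_measure_bind[OF circle_probD(1)[OF \<mu>] measurable_arc_mixture[OF \<mu> \<nu>P]])
         (auto intro: \<nu> simp: arc_point_def)
    then have "arc_mixture \<nu> \<mu> m \<in> weak_topology closure_of (rigidity_set n \<epsilon>)" for m
      using rigid_measure_in_rigidity_set[OF _ \<open>\<epsilon> > 0\<close>]
      by (intro subsetD[OF closure_of_subset]) (auto simp: rigidity_set_def)
    ultimately show "\<mu> \<in> weak_topology closure_of (rigidity_set n \<epsilon>)"
      using limitin_closedin[OF _ closedin_closure_of] by (metis always_eventually sequentially_bot)
  qed
qed

section \<open>Open conditions on measures\<close>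

text \<open>A finite set of pairs \<open>(f, c)\<close> encodes the weakly open, convex condition that
  \<open>\<integral> f d\<mu> < c\<close> for all its members.\<close>

definition admissible :: "((complex \<Rightarrow> real) \<times> real) set \<Rightarrow> bool" where
  "admissible G \<longleftrightarrow> finite G \<and> (\<forall>(f, c) \<in> G. continuous_on unit_circle f)"

definition satisfies :: "complex measure \<Rightarrow> ((complex \<Rightarrow> real) \<times> real) set \<Rightarrow> bool" where
  "satisfies \<mu> G \<longleftrightarrow> (\<forall>(f, c) \<in> G. (\<integral>z. f z \<partial>\<mu>) < c)"

lemma admissible_Un [simp]: "admissible (G \<union> H) \<longleftrightarrow> admissible G \<and> admissible H"
  by (auto simp: admissible_def)

lemma satisfies_Un [simp]: "satisfies \<mu> (G \<union> H) \<longleftrightarrow> satisfies \<mu> G \<and> satisfies \<mu> H"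
  by (auto simp: satisfies_def)

text \<open>The finitely many strict inequalities in \<open>G\<close> cut out a weakly open
  neighbourhood of \<open>\<mu>\<close>. The converse direction uses density only in this
  form.\<close>

lemma dense_satisfies:
  assumes dense: "weak_topology closure_of S = circle_prob"
    and \<mu>: "\<mu> \<in> circle_prob" and G: "admissible G" "satisfies \<mu> G"
  obtains \<nu> where "\<nu> \<in> S" "satisfies \<nu> G"
proof -
  define V where "V = (\<lambda>(f :: complex \<Rightarrow> real, c). {\<nu> \<in> circle_prob. (\<integral>z. f z \<partial>\<nu>) \<in> {..<c}})"
  have "openin weak_topology (V p)" if "p \<in> G" for p
  proof -
    obtain f c where [simp]: "p = (f, c)" by (cases p)
    have "continuous_on unit_circle f"
      using G that by (auto simp: admissible_def)
    then show ?thesis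
      unfolding weak_topology_def V_def
      by (intro topology_generated_by_Basis) (use open_lessThan in \<open>auto intro!: exI[of _ f] exI[of _ "{..<c}"]\<close>)
  qed
  \<comment> \<open>Inserting the whole space keeps the intersected family nonempty when
    \<open>G\<close> is empty.\<close>
  then have "openin weak_topology (\<Inter>(insert circle_prob (V ` G)))"
    using G openin_topspace[of weak_topology] by (intro openin_Inter) (auto simp: admissible_def)
  then have "openin weak_topology (circle_prob \<inter> \<Inter>(V ` G))"
    by simp
  moreover have "\<mu> \<in> circle_prob \<inter> \<Inter>(V ` G)"
    using \<mu> G by (auto simp: V_def satisfies_def)
  moreover have "\<mu> \<in> weak_topology closure_of S"
    using dense \<mu> by simp
  ultimately obtain \<nu> where "\<nu> \<in> S" "\<nu> \<in> circle_prob \<inter> \<Inter>(V ` G)"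
    unfolding in_closure_of by blast
  then show ?thesis
    using that by (auto simp: V_def satisfies_def)
qed

section \<open>Atoms\<close>

text \<open>For \<open>w\<close> on the circle this is normalised arc length on the arc of length
  \<open>1 / Suc m\<close> running counterclockwise from \<open>w\<close>: a continuous substitute
  for the point mass at \<open>w\<close>.\<close>

definition arc_measure :: "nat \<Rightarrow> complex \<Rightarrow> complex measure" where
  "arc_measure m w = distr (uniform_measure lborel {Arg w..Arg w + 1 / real (Suc m)}) circle_borel cis"

lemma measurable_cis_circle: "cis \<in> borel \<rightarrow>\<^sub>M circle_borel"
  by (intro measurable_restrict_space2 borel_measurable_continuous_onI continuous_intros) auto

text \<open>A point has only countably many preimages under \<open>cis\<close>, hence a Lebesgue
  null set of them.\<close>

lemma
  assumes "w \<in> unit_circle"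
  shows arc_measure_circle_prob_cont: "arc_measure m w \<in> circle_prob_cont"
    and arc_measure_near: "AE z in arc_measure m w. dist z w \<le> 1 / real (Suc m)"
proof -
  define A where "A = {Arg w..Arg w + 1 / real (Suc m)}"
  have A: "emeasure lborel A \<noteq> 0" "emeasure lborel A \<noteq> \<infinity>" "A \<in> sets lborel"
    by (simp_all add: A_def)
  have meas: "cis \<in> uniform_measure lborel A \<rightarrow>\<^sub>M circle_borel"
    using measurable_cis_circle by simp
  have P: "arc_measure m w \<in> circle_prob"
    unfolding arc_measure_def A_def[symmetric]
    by (intro distr_circle_prob prob_space_uniform_measure A meas)
  moreover have "emeasure (arc_measure m w) {z} = 0" if z: "z \<in> unit_circle" for z
  proof -
    have sets: "{z} \<in> sets circle_borel"
      using z by (intro circle_borel_setsI) auto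
    have "cis -` {z} \<subseteq> (\<lambda>k. Arg z + of_int k * (2 * pi)) ` UNIV"
    proof
      fix t assume "t \<in> cis -` {z}"
      then have "cis (t - Arg z) = 1"
        using z by (auto simp: cis_divide[symmetric] cis_Arg_circle)
      then have "cos (t - Arg z) = 1"
        by (metis cis.sel(1) one_complex.sel(1))
      then obtain k :: int where "t - Arg z = of_int k * 2 * pi"
        unfolding cos_one_2pi_int by blast
      then have "t = Arg z + of_int k * (2 * pi)" by simp
      then show "t \<in> (\<lambda>k. Arg z + of_int k * (2 * pi)) ` UNIV" by blast
    qed
    then have "countable (cis -` {z})"
      by (rule countable_subset) simp
    then have "countable (A \<inter> cis -` {z})"
      by auto
    then have null: "emeasure lborel (A \<inter> cis -` {z}) = 0"
      by (rule emeasure_lborel_countable)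
    have "cis -` {z} \<in> sets borel"
      using \<open>countable (cis -` {z})\<close> countable_imp_null_set_lborel by fastforce
    then show ?thesis
      unfolding arc_measure_def A_def[symmetric]
      using null A by (simp add: emeasure_distr[OF meas sets])
  qed
  ultimately show "arc_measure m w \<in> circle_prob_cont"
    by (simp add: circle_prob_cont_def)
  show "AE z in arc_measure m w. dist z w \<le> 1 / real (Suc m)"
    unfolding arc_measure_def A_def[symmetric]
  proof (subst AE_distr_iff[OF meas])
    have "{x \<in> space circle_borel. dist x w \<le> 1 / real (Suc m)} = cball w (1 / real (Suc m)) \<inter> unit_circle"
      by (auto simp: space_restrict_space dist_commute)
    then show "{x \<in> space circle_borel. dist x w \<le> 1 / real (Suc m)} \<in> sets circle_borel"
      by (auto intro!: circle_borel_setsI)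
    have "dist (cis t) w \<le> 1 / real (Suc m)" if "t \<in> A" for t
    proof -
      have "dist (cis t) w \<le> \<bar>t - Arg w\<bar>"
        using dist_cis_le[of t "Arg w"] assms by (simp add: cis_Arg_circle)
      also have "\<dots> \<le> 1 / real (Suc m)"
        using that by (auto simp: A_def)
      finally show ?thesis .
    qed
    then show "AE t in uniform_measure lborel A. dist (cis t) w \<le> 1 / real (Suc m)"
      using A by (intro AE_uniform_measureI AE_I2) auto
  qed
qed

text \<open>A mixture of arc measures has no atoms, since each of its components gives every point
  mass 0.\<close>

lemma circle_prob_cont_dense: "weak_topology closure_of circle_prob_cont = circle_prob"
proof
  show "weak_topology closure_of circle_prob_cont \<subseteq> circle_prob"
    using closure_of_subset_topspace[of weak_topology] by simp
  show "circle_prob \<subseteq> weak_topology closure_of circle_prob_cont"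
  proof
    fix \<mu> assume \<mu>: "\<mu> \<in> circle_prob"
    have P: "arc_measure m w \<in> circle_prob" if "w \<in> unit_circle" for m w
      using arc_measure_circle_prob_cont[OF that] by (simp add: circle_prob_cont_def)
    have "arc_mixture arc_measure \<mu> m \<in> circle_prob_cont" for m
    proof -
      have "emeasure (arc_mixture arc_measure \<mu> m) {z} = 0" if z: "z \<in> unit_circle" for z
      proof -
        have "emeasure (arc_mixture arc_measure \<mu> m) {z}
            = (\<integral>\<^sup>+x. emeasure (arc_measure m (arc_point m (arc_index m x))) {z} \<partial>\<mu>)"
          unfolding arc_mixture_def using z
          by (intro emeasure_bind_circle[OF circle_probD(1)[OF \<mu>] measurable_arc_mixture[OF \<mu> P]] P)
             (auto simp: arc_point_def intro!: circle_borel_setsI)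
        also have "\<dots> = (\<integral>\<^sup>+x. 0 \<partial>\<mu>)"
          using arc_measure_circle_prob_cont z
          by (intro nn_integral_cong) (auto simp: circle_prob_cont_def arc_point_def)
        finally show ?thesis by simp
      qed
      then show ?thesis
        using arc_mixture_circle_prob[OF \<mu> P] by (simp add: circle_prob_cont_def)
    qed
    then have "arc_mixture arc_measure \<mu> m \<in> weak_topology closure_of circle_prob_cont" for m
      by (intro subsetD[OF closure_of_subset]) (auto simp: circle_prob_cont_def)
    moreover have "limitin weak_topology (arc_mixture arc_measure \<mu>) \<mu> sequentially"
      using \<mu> P arc_measure_near by (rule limitin_arc_mixture)
    ultimately show "\<mu> \<in> weak_topology closure_of circle_prob_cont"
      using limitin_closedin[OF _ closedin_closure_of] by (metis always_eventually sequentially_bot)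
  qed
qed

text \<open>A certificate by weakly open conditions that all atoms are smaller than
  \<open>c\<close>: the mass at \<open>z\<close> is at most the integral of a nonnegative function
  that is at least 1 at \<open>z\<close>. Such integral bounds can be imposed on approximants and
  pass to weak limits as non-strict inequalities.\<close>

definition atom_test :: "real \<Rightarrow> ((complex \<Rightarrow> real) \<times> real) set \<Rightarrow> bool" where
  "atom_test c G \<longleftrightarrow>
     (\<forall>z\<in>unit_circle. \<exists>f. (f, c) \<in> G \<and> (\<forall>x\<in>unit_circle. 0 \<le> f x) \<and> 1 \<le> f z)"

lemma atom_le_integral:
  fixes f :: "complex \<Rightarrow> real"
  assumes \<mu>: "\<mu> \<in> circle_prob" and f: "continuous_on unit_circle f"
    and "\<And>x. x \<in> unit_circle \<Longrightarrow> 0 \<le> f x" and z: "z \<in> unit_circle" "1 \<le> f z"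
  shows "measure \<mu> {z} \<le> (\<integral>x. f x \<partial>\<mu>)"
proof -
  interpret prob_space \<mu> using \<mu> by (simp add: circle_probD)
  have "{z} \<in> sets \<mu>"
    using z by (auto simp: circle_probD(2)[OF \<mu>] intro!: circle_borel_setsI)
  then have "measure \<mu> {z} = (\<integral>x. indicator {z} x \<partial>\<mu>)"
    by simp
  also have "\<dots> \<le> (\<integral>x. f x \<partial>\<mu>)"
    using assms \<open>{z} \<in> sets \<mu>\<close> integrable_circle_prob[OF \<mu> f]
    by (intro integral_mono)
       (auto simp: circle_probD(3)[OF \<mu>] emeasure_eq_measure split: split_indicator)
  finally show ?thesis .
qed

text \<open>Around each point a sufficiently narrow bump has integral below \<open>c\<close>,
  because the bumps shrink to the indicator of the point. Finitely many bumps suffice by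
  compactness.\<close>

lemma atom_test_exists:
  assumes \<mu>: "\<mu> \<in> circle_prob" and c: "\<And>z. z \<in> unit_circle \<Longrightarrow> measure \<mu> {z} < c"
  obtains H where "admissible H" "satisfies \<mu> H" "atom_test c H"
proof -
  interpret prob_space \<mu> using \<mu> by (simp add: circle_probD)
  \<comment> \<open>For \<open>j > 0\<close> a bump that equals 1 within distance
    \<open>1 / j\<close> of \<open>w\<close> and 0 beyond \<open>2 / j\<close>.\<close>
  define f :: "complex \<Rightarrow> nat \<Rightarrow> complex \<Rightarrow> real"
    where "f w j x = max 0 (min 1 (2 - real j * dist x w))" for w j x
  have cont: "continuous_on unit_circle (f w j)" for w j
    unfolding f_def by (intro continuous_intros)
  have "\<exists>j>0. (\<integral>x. f w j x \<partial>\<mu>) < c" if w: "w \<in> unit_circle" for w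
  proof -
    have "(\<lambda>j. f w j x) \<longlonglongrightarrow> indicator {w} x" for x
    proof (cases "x = w")
      case False
      obtain j0 where j0: "real j0 * dist x w > 2"
        using False reals_Archimedean3[of "dist x w"] by (auto simp: mult.commute)
      have "f w j x = 0" if "j \<ge> j0" for j
      proof -
        have "real j0 * dist x w \<le> real j * dist x w"
          using that by (intro mult_right_mono) auto
        then show ?thesis
          using j0 by (simp add: f_def)
      qed
      then have "\<forall>\<^sub>F j in sequentially. f w j x = 0"
        unfolding eventually_sequentially by blast
      then show ?thesis
        using False by (simp add: tendsto_eventually)
    qed (simp add: f_def)
    then have "(\<lambda>j. \<integral>x. f w j x \<partial>\<mu>) \<longlonglongrightarrow> (\<integral>x. indicator {w} x \<partial>\<mu>)"
    proof (intro integral_dominated_convergence[where w="\<lambda>_. 1"])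
      show "indicator {w} \<in> borel_measurable \<mu>"
        using w by (intro borel_measurable_indicator)
          (auto simp: circle_probD(2)[OF \<mu>] intro!: circle_borel_setsI)
      show "AE x in \<mu>. norm (f w j x) \<le> 1" for j
        by (simp add: f_def)
    qed (use borel_measurable_circle_prob[OF \<mu> cont] in auto)
    also have "(\<integral>x. indicator {w} x \<partial>\<mu>) = measure \<mu> {w}"
      using w by (simp add: circle_probD(3)[OF \<mu>])
    finally have "\<forall>\<^sub>F j in sequentially. (\<integral>x. f w j x \<partial>\<mu>) < c"
      using c[OF w] by (rule order_tendstoD)
    \<comment> \<open>Positivity matters because \<open>1 / j\<close> becomes the radius of a
      covering ball, and \<open>1 / 0 = 0\<close> would make it empty.\<close>
    then have "\<forall>\<^sub>F j in sequentially. j > 0 \<and> (\<integral>x. f w j x \<partial>\<mu>) < c"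
      using eventually_gt_at_top[of 0] by eventually_elim simp
    then show ?thesis
      using eventually_happens sequentially_bot by blast
  qed
  then obtain j where j: "\<And>w. w \<in> unit_circle \<Longrightarrow> j w > 0 \<and> (\<integral>x. f w (j w) x \<partial>\<mu>) < c"
    by metis
  have "unit_circle \<subseteq> (\<Union>w\<in>unit_circle. ball w (1 / real (j w)))"
    using j by force
  then obtain W where W: "W \<subseteq> unit_circle" "finite W" "unit_circle \<subseteq> (\<Union>w\<in>W. ball w (1 / real (j w)))"
    by (rule compactE_image[OF compact_sphere, rotated]) auto
  define H where "H = (\<lambda>w. (f w (j w), c)) ` W"
  show ?thesis
  proof (rule that[of H])
    show "admissible H"
      using W cont by (auto simp: admissible_def H_def)
    show "satisfies \<mu> H"
      using W j by (auto simp: satisfies_def H_def)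
    show "atom_test c H"
      unfolding atom_test_def
    proof
      fix z :: complex assume "z \<in> unit_circle"
      then obtain w where w: "w \<in> W" "dist z w < 1 / real (j w)"
        using W(3) by (auto simp: dist_commute)
      then have "j w > 0" using j W by blast
      then have "f w (j w) z \<ge> 1"
        using w by (simp add: f_def field_simps)
      then show "\<exists>f. (f, c) \<in> H \<and> (\<forall>x\<in>unit_circle. 0 \<le> f x) \<and> 1 \<le> f z"
        using w by (intro exI[of _ "f w (j w)"]) (auto simp: H_def f_def)
    qed
  qed
qed

lemma atom_test_satisfies:
  assumes "\<mu> \<in> circle_prob" "admissible H" "satisfies \<mu> H" "atom_test c H" "z \<in> unit_circle"
  shows "measure \<mu> {z} < c"
proof -
  obtain f where f: "(f, c) \<in> H" "\<forall>x\<in>unit_circle. 0 \<le> f x" "1 \<le> f z"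
    using assms unfolding atom_test_def by blast
  have "measure \<mu> {z} \<le> (\<integral>x. f x \<partial>\<mu>)"
    using assms f by (intro atom_le_integral) (auto simp: admissible_def)
  also have "\<dots> < c"
    using f assms by (auto simp: satisfies_def)
  finally show ?thesis .
qed

section \<open>Sequential compactness\<close>

text \<open>Transport to the line by \<open>Arg\<close>, where the images live on a bounded interval
  and are tight, extract a weakly convergent subsequence, and return by \<open>cis\<close>. The jump
  of \<open>Arg\<close> does no harm: only the functions \<open>f (cis t)\<close> are tested, and
  these are continuous on the whole line.\<close>

lemma circle_prob_seq_compact:
  assumes X: "\<And>p. X p \<in> circle_prob"
  obtains r \<mu> where "strict_mono (r :: nat \<Rightarrow> nat)" "limitin weak_topology (X \<circ> r) \<mu> sequentially"
proof -
  define Y where "Y p = distr (X p) borel Arg" for p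
  have meas: "Arg \<in> X p \<rightarrow>\<^sub>M borel" for p
    using measurable_restrict_space1[OF borel_measurable_Arg, of unit_circle]
    by (simp add: measurable_cong_sets[OF circle_probD(2)[OF X] refl])
  have Y: "real_distribution (Y p)" for p
    unfolding Y_def using prob_space.prob_space_distr[OF circle_probD(1)[OF X] meas]
    by (auto intro!: real_distribution.intro simp: real_distribution_axioms_def)
  have "measure (Y p) {-pi<..pi} = 1" for p
  proof -
    have "measure (Y p) {-pi<..pi} = measure (X p) (Arg -` {-pi<..pi} \<inter> space (X p))"
      unfolding Y_def by (rule measure_distr[OF meas]) simp
    also have "Arg -` {-pi<..pi} \<inter> space (X p) = space (X p)"
      using Arg_bounded by auto
    finally show ?thesis
      using prob_space.prob_space[OF circle_probD(1)[OF X]] by simp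
  qed
  then have "tight Y"
    unfolding tight_def using Y pi_gt_zero
    by (intro conjI allI impI exI[of _ "- pi"] exI[of _ pi]) simp_all
  then obtain r M where r: "strict_mono r" and M: "real_distribution M"
    and conv: "weak_conv_m (Y \<circ> id \<circ> r) M"
    using tight_imp_convergent_subsubsequence[OF _ strict_mono_id] by blast
  have meas_M: "cis \<in> M \<rightarrow>\<^sub>M circle_borel"
    using measurable_cis_circle
    by (simp add: measurable_cong_sets[OF real_distribution.events_eq_borel[OF M] refl])
  define \<mu> where "\<mu> = distr M circle_borel cis"
  have "limitin weak_topology (X \<circ> r) \<mu> sequentially"
    unfolding limitin_weak_topology
  proof (intro conjI allI impI)
    show "\<mu> \<in> circle_prob"
      unfolding \<mu>_def using M by (intro distr_circle_prob meas_M) (simp add: real_distribution_def)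
    show "\<forall>\<^sub>F i in sequentially. (X \<circ> r) i \<in> circle_prob"
      using X by simp
    fix f :: "complex \<Rightarrow> real" assume f: "continuous_on unit_circle f"
    obtain B where B: "\<And>z. z \<in> unit_circle \<Longrightarrow> norm (f z) \<le> B"
      using continuous_on_circle_bounded[OF f] by metis
    have "continuous_on UNIV (\<lambda>t. f (cis t))"
      by (rule continuous_on_compose2[OF f]) (auto intro!: continuous_intros)
    then have cont: "isCont (\<lambda>t. f (cis t)) t" for t
      by (simp add: continuous_on_eq_continuous_at)
    have "(\<lambda>p. \<integral>t. f (cis t) \<partial>(Y \<circ> id \<circ> r) p) \<longlonglongrightarrow> (\<integral>t. f (cis t) \<partial>M)"
      by (rule weak_conv_imp_integral_bdd_continuous_conv[OF _ M conv cont, where B=B]) (use B in \<open>auto simp: Y\<close>)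
    moreover have "(\<integral>t. f (cis t) \<partial>Y p) = (\<integral>z. f z \<partial>X p)" for p
    proof -
      have "(\<integral>t. f (cis t) \<partial>Y p) = (\<integral>z. f (cis (Arg z)) \<partial>X p)"
        unfolding Y_def by (rule integral_distr[OF meas])
          (intro borel_measurable_continuous_onI, fact)
      also have "\<dots> = (\<integral>z. f z \<partial>X p)"
        by (rule Bochner_Integration.integral_cong) (auto simp: circle_probD(3)[OF X] cis_Arg_circle)
      finally show ?thesis .
    qed
    moreover have "(\<integral>t. f (cis t) \<partial>M) = (\<integral>z. f z \<partial>\<mu>)"
      unfolding \<mu>_def by (rule integral_distr_circle[OF meas_M f, symmetric])
    ultimately show "(\<lambda>i. \<integral>z. f z \<partial>(X \<circ> r) i) \<longlonglongrightarrow> (\<integral>z. f z \<partial>\<mu>)"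
      by simp
  qed
  with r show ?thesis by (rule that)
qed

section \<open>Averaging over disjoint bad windows\<close>

lemma rigidity_set_eventually:
  assumes "\<rho> \<in> rigidity_set n \<epsilon>"
  shows "\<forall>\<^sub>F k in sequentially. cmod (fourier_coeff \<rho> (n k) - 1) < \<epsilon>"
  using Limsup_lessD[of sequentially "\<lambda>k. ereal (cmod (fourier_coeff \<rho> (n k) - 1))" "ereal \<epsilon>"] assms
  by (simp add: rigidity_set_def)

text \<open>\<open>\<mu>\<close> may have large atoms and then satisfies no useful atom test. It is
  therefore first replaced by a nearby continuous \<open>\<nu>\<close>; an atom test valid for
  \<open>\<nu>\<close> is then added to the open conditions under which the rigidity set is
  entered.\<close>

lemma approximant_agreeing_up_to:
  assumes dense: "weak_topology closure_of (rigidity_set n \<epsilon>) = circle_prob"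
    and \<mu>: "\<mu> \<in> circle_prob" and G: "admissible G" "satisfies \<mu> G" and "\<delta> > 0" "c > 0"
  obtains \<rho> where "\<rho> \<in> rigidity_set n \<epsilon>" "satisfies \<rho> G" "\<And>z. z \<in> unit_circle \<Longrightarrow> measure \<rho> {z} < c"
    "\<And>k. k < K \<Longrightarrow> cmod (fourier_coeff \<rho> (n k) - fourier_coeff \<mu> (n k)) < \<delta>"
proof -
  \<comment> \<open>Upper and lower bounds of width \<open>\<delta> / 2\<close> on real and
    imaginary parts; together they give \<open>\<delta>\<close> for the modulus.\<close>
  define F :: "((complex \<Rightarrow> real) \<times> real) set" where "F = (\<Union>k<K.
    {(\<lambda>z. Re (z powi n k), Re (fourier_coeff \<mu> (n k)) + \<delta> / 2),
     (\<lambda>z. - Re (z powi n k), - Re (fourier_coeff \<mu> (n k)) + \<delta> / 2),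
     (\<lambda>z. Im (z powi n k), Im (fourier_coeff \<mu> (n k)) + \<delta> / 2),
     (\<lambda>z. - Im (z powi n k), - Im (fourier_coeff \<mu> (n k)) + \<delta> / 2)})"
  have "admissible F"
    unfolding admissible_def F_def by (auto intro!: continuous_intros)
  moreover have "satisfies \<mu> F"
    using \<open>\<delta> > 0\<close> by (auto simp: satisfies_def F_def Re_Im_fourier_coeff[OF \<mu>])
  ultimately obtain \<nu> where \<nu>: "\<nu> \<in> circle_prob_cont" "satisfies \<nu> (G \<union> F)"
    using dense_satisfies[OF circle_prob_cont_dense \<mu>, of "G \<union> F"] G by auto
  then have \<nu>P: "\<nu> \<in> circle_prob"
    by (simp add: circle_prob_cont_def)
  have "measure \<nu> {z} < c" if "z \<in> unit_circle" for z
    using \<nu>(1) that \<open>c > 0\<close> by (simp add: circle_prob_cont_def measure_def)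
  then obtain H where H: "admissible H" "satisfies \<nu> H" "atom_test c H"
    using atom_test_exists[OF \<nu>P] by metis
  then obtain \<rho> where \<rho>: "\<rho> \<in> rigidity_set n \<epsilon>" "satisfies \<rho> (G \<union> F \<union> H)"
    using dense_satisfies[OF dense \<nu>P, of "G \<union> F \<union> H"] G \<nu> \<open>admissible F\<close> by auto
  then have \<rho>P: "\<rho> \<in> circle_prob"
    by (simp add: rigidity_set_def)
  show ?thesis
  proof (rule that)
    show "\<rho> \<in> rigidity_set n \<epsilon>" "satisfies \<rho> G"
      using \<rho> by auto
    show "measure \<rho> {z} < c" if "z \<in> unit_circle" for z
      using H \<rho> \<rho>P that by (intro atom_test_satisfies[of _ H]) auto
    fix k assume "k < K"
    let ?d = "fourier_coeff \<rho> (n k) - fourier_coeff \<mu> (n k)"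
    have "satisfies \<rho> F"
      using \<rho> by simp
    then have "Re ?d < \<delta> / 2" "- Re ?d < \<delta> / 2" "Im ?d < \<delta> / 2" "- Im ?d < \<delta> / 2"
      using \<open>k < K\<close> unfolding satisfies_def F_def
      by (auto simp: Re_Im_fourier_coeff[OF \<rho>P] dest!: bspec[where x=k])
    then show "cmod ?d < \<delta>"
      using cmod_le[of ?d] by linarith
  qed
qed

text \<open>The \<open>i\<close>-th measure of the average is uncontrolled only for \<open>K i \<le> k < K (Suc i)\<close>. These windows
  are disjoint, so that the average is off by at most \<open>2 / N\<close>.\<close>

lemma rigidity_improvement_step:
  assumes dense: "weak_topology closure_of (rigidity_set n \<epsilon>) = circle_prob"
    and \<mu>: "\<mu> \<in> circle_prob" and G: "admissible G" "satisfies \<mu> G"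
    and pos: "\<delta> > 0" "c > 0" 
  obtains \<nu> where "\<nu> \<in> circle_prob" "satisfies \<nu> G" "\<And>z. z \<in> unit_circle \<Longrightarrow> measure \<nu> {z} \<le> c"
    "\<forall>\<^sub>F k in sequentially. cmod (fourier_coeff \<nu> (n k) - 1) \<le> \<epsilon>"
    "\<And>k. cmod (fourier_coeff \<nu> (n k) - 1) \<le> max (cmod (fourier_coeff \<mu> (n k) - 1)) \<epsilon> + \<delta>"
proof -
  \<comment> \<open>From \<open>K'\<close> on the approximant is close to 1; this index is where the
    next approximant will take over.\<close>
  have "\<exists>\<rho> K'. \<rho> \<in> rigidity_set n \<epsilon> \<and> satisfies \<rho> G \<and> (\<forall>z\<in>unit_circle. measure \<rho> {z} < c) \<and>
      (\<forall>k<K. cmod (fourier_coeff \<rho> (n k) - fourier_coeff \<mu> (n k)) < \<delta> / 2) \<and>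
      K \<le> K' \<and> (\<forall>k\<ge>K'. cmod (fourier_coeff \<rho> (n k) - 1) < \<epsilon>)" for K
  proof -
    obtain \<rho> where \<rho>: "\<rho> \<in> rigidity_set n \<epsilon>" "satisfies \<rho> G" "\<And>z. z \<in> unit_circle \<Longrightarrow> measure \<rho> {z} < c"
      "\<And>k. k < K \<Longrightarrow> cmod (fourier_coeff \<rho> (n k) - fourier_coeff \<mu> (n k)) < \<delta> / 2"
      using approximant_agreeing_up_to[OF dense \<mu> G half_gt_zero[OF pos(1)] pos(2)] by metis
    obtain K' where "\<forall>k\<ge>K'. cmod (fourier_coeff \<rho> (n k) - 1) < \<epsilon>"
      using rigidity_set_eventually[OF \<rho>(1)] unfolding eventually_sequentially by blast
    then have "K \<le> max K K' \<and> (\<forall>k\<ge>max K K'. cmod (fourier_coeff \<rho> (n k) - 1) < \<epsilon>)"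
      by simp
    with \<rho> show ?thesis by blast
  qed
  then obtain \<sigma> J where \<sigma>: "\<And>K. \<sigma> K \<in> rigidity_set n \<epsilon>" "\<And>K. satisfies (\<sigma> K) G"
      "\<And>K z. z \<in> unit_circle \<Longrightarrow> measure (\<sigma> K) {z} < c"
      "\<And>K k. k < K \<Longrightarrow> cmod (fourier_coeff (\<sigma> K) (n k) - fourier_coeff \<mu> (n k)) < \<delta> / 2"
      "\<And>K. K \<le> J K" "\<And>K k. k \<ge> J K \<Longrightarrow> cmod (fourier_coeff (\<sigma> K) (n k) - 1) < \<epsilon>"
    by metis
  \<comment> \<open>Iterating \<open>J\<close> makes consecutive windows abut: the end of one is the
    start of the next.\<close>
  define K where "K i = (J ^^ i) 0" for i
  define \<rho> where "\<rho> i = \<sigma> (K i)" for i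
  have \<rho>P: "\<rho> i \<in> circle_prob" for i
    using \<sigma>(1) by (simp add: \<rho>_def rigidity_set_def)
  have K_mono: "K i \<le> K (Suc i)" for i
    using \<sigma>(5) by (simp add: K_def)
  \<comment> \<open>One half of \<open>\<delta>\<close> pays for the imperfect agreement with
    \<open>\<mu>\<close>, the other for the share \<open>2 / N\<close> of the one uncontrolled
    measure.\<close>
  obtain N :: nat where N: "2 / (\<delta> / 2) < real N"
    using reals_Archimedean2 by blast
  moreover have "0 < 2 / (\<delta> / 2)"
    using \<open>\<delta> > 0\<close> by simp
  ultimately have N_pos: "N > 0"
    by linarith
  then have N_large: "2 / real N < \<delta> / 2"
    using N \<open>\<delta> > 0\<close> by (simp add: field_simps)
  define \<nu> where "\<nu> = bind (measure_pmf (pmf_of_set {..<N})) \<rho>"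
  have kernel: "\<rho> \<in> measure_pmf (pmf_of_set {..<N}) \<rightarrow>\<^sub>M subprob_algebra circle_borel"
    by (rule measurable_subprob_algebra_via_countable[where g="\<lambda>i. i"]) (simp_all add: \<rho>P)
  note bind = measure_pmf.prob_space_axioms kernel \<rho>P
  have \<nu>P: "\<nu> \<in> circle_prob"
    unfolding \<nu>_def by (rule bind_circle_prob[OF bind])
  have avg: "measure_pmf.expectation (pmf_of_set {..<N}) g = (\<Sum>i<N. g i) / real N" for g :: "nat \<Rightarrow> real"
    using N_pos by (subst integral_pmf_of_set) auto
  have "fourier_coeff \<nu> m = (\<Sum>i<N. fourier_coeff (\<rho> i) m) / of_nat N" for m
    using fourier_coeff_bind[OF bind, of m] by (simp add: complex_eq_iff \<nu>_def avg)
  then have fc: "fourier_coeff \<nu> m - 1 = (\<Sum>i<N. fourier_coeff (\<rho> i) m - 1) / of_nat N" for m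
    using N_pos by (simp add: sum_subtractf field_simps)
  have fc_le: "cmod (fourier_coeff \<nu> m - 1) \<le> (\<Sum>i<N. cmod (fourier_coeff (\<rho> i) m - 1)) / real N" for m
    unfolding fc norm_divide by (simp add: divide_right_mono sum_norm_le)
  show ?thesis
  proof (rule that[of \<nu>])
    show "\<nu> \<in> circle_prob" by (rule \<nu>P)
    \<comment> \<open>The conditions are convex, hence inherited by averages; \<open>N > 0\<close>
      keeps the inequality strict.\<close>
    show "satisfies \<nu> G"
      unfolding satisfies_def
    proof clarify
      fix f c assume fc: "(f, c) \<in> G"
      then have "continuous_on unit_circle f"
        using G by (auto simp: admissible_def)
      from integral_bind_circle[OF bind this]
      have "(\<integral>z. f z \<partial>\<nu>) = (\<Sum>i<N. \<integral>z. f z \<partial>\<rho> i) / real N"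
        by (simp add: \<nu>_def avg)
      also have "(\<Sum>i<N. \<integral>z. f z \<partial>\<rho> i) < (\<Sum>i<N. c)"
        using fc \<sigma>(2) N_pos by (intro sum_strict_mono) (auto simp: satisfies_def \<rho>_def)
      then have "(\<Sum>i<N. \<integral>z. f z \<partial>\<rho> i) / real N < c"
        using N_pos by (simp add: field_simps)
      finally show "(\<integral>z. f z \<partial>\<nu>) < c" .
    qed
    show "measure \<nu> {z} \<le> c" if z: "z \<in> unit_circle" for z
    proof -
      have "emeasure \<nu> {z} = (\<integral>\<^sup>+i. emeasure (\<rho> i) {z} \<partial>measure_pmf (pmf_of_set {..<N}))"
        unfolding \<nu>_def using z by (intro emeasure_bind_circle[OF bind] circle_borel_setsI) auto
      also have "\<dots> \<le> (\<integral>\<^sup>+i. ennreal c \<partial>measure_pmf (pmf_of_set {..<N}))"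
      proof (rule nn_integral_mono)
        fix i
        interpret prob_space "\<rho> i" using \<rho>P by (simp add: circle_probD)
        have "measure (\<rho> i) {z} < c"
          using \<sigma>(3)[OF z] by (simp add: \<rho>_def)
        then show "emeasure (\<rho> i) {z} \<le> ennreal c"
          by (simp add: emeasure_eq_measure ennreal_leI)
      qed
      also have "\<dots> = ennreal c" by simp
      finally show ?thesis
        using \<open>c > 0\<close> by (simp add: measure_def enn2real_leI)
    qed
    have "\<forall>\<^sub>F k in sequentially. \<forall>i\<in>{..<N}. cmod (fourier_coeff (\<rho> i) (n k) - 1) < \<epsilon>"
      using rigidity_set_eventually[OF \<sigma>(1)] by (intro eventually_ball_finite) (auto simp: \<rho>_def)
    then show "\<forall>\<^sub>F k in sequentially. cmod (fourier_coeff \<nu> (n k) - 1) \<le> \<epsilon>"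
    proof eventually_elim
      case (elim k)
      have "(\<Sum>i<N. cmod (fourier_coeff (\<rho> i) (n k) - 1)) \<le> (\<Sum>i<N. \<epsilon>)"
        using elim by (intro sum_mono) (auto intro: less_imp_le)
      then have "(\<Sum>i<N. cmod (fourier_coeff (\<rho> i) (n k) - 1)) / real N \<le> \<epsilon>"
        using N_pos by (simp add: field_simps)
      with fc_le[of "n k"] show ?case by linarith
    qed
    fix k
    define M where "M = max (cmod (fourier_coeff \<mu> (n k) - 1)) \<epsilon>"
    have "M \<ge> 0" by (simp add: M_def max.coboundedI1)
    \<comment> \<open>Since \<open>K\<close> is monotone, the difference of the two truth values is
      the indicator of the \<open>i\<close>-th window. In this form the sum over \<open>i\<close>
      telescopes to at most 1, and 2 bounds the error inside a window.\<close>
    have "cmod (fourier_coeff (\<rho> i) (n k) - 1)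
        \<le> M + \<delta> / 2 + 2 * (of_bool (k < K (Suc i)) - of_bool (k < K i))" for i
    proof -
      consider "k < K i" | "K (Suc i) \<le> k" | "K i \<le> k" "k < K (Suc i)"
        by linarith
      then show ?thesis
      proof cases
        case 1
        have "cmod (fourier_coeff (\<rho> i) (n k) - 1)
            \<le> cmod (fourier_coeff (\<rho> i) (n k) - fourier_coeff \<mu> (n k)) + cmod (fourier_coeff \<mu> (n k) - 1)"
          using norm_triangle_ineq[of "fourier_coeff (\<rho> i) (n k) - fourier_coeff \<mu> (n k)" "fourier_coeff \<mu> (n k) - 1"]
          by simp
        moreover have "cmod (fourier_coeff (\<rho> i) (n k) - fourier_coeff \<mu> (n k)) < \<delta> / 2"
          unfolding \<rho>_def using 1 by (rule \<sigma>(4))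
        moreover have "k < K (Suc i)"
          using 1 K_mono[of i] by linarith
        ultimately show ?thesis
          using 1 by (simp add: M_def)
      next
        case 2
        then have "cmod (fourier_coeff (\<rho> i) (n k) - 1) < \<epsilon>"
          unfolding \<rho>_def by (intro \<sigma>(6)) (simp add: K_def)
        moreover have "\<not> k < K i" "\<not> k < K (Suc i)"
          using 2 K_mono[of i] by linarith+
        ultimately show ?thesis
          using \<open>\<delta> > 0\<close> by (simp add: M_def)
      next
        case 3
        have "cmod (fourier_coeff (\<rho> i) (n k) - 1) \<le> 2"
          using norm_triangle_ineq4[of "fourier_coeff (\<rho> i) (n k)" 1] cmod_fourier_coeff_le[OF \<rho>P, of i "n k"]
          by simp
        then show ?thesis
          using 3 \<open>M \<ge> 0\<close> \<open>\<delta> > 0\<close> by simp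
      qed
    qed
    then have "(\<Sum>i<N. cmod (fourier_coeff (\<rho> i) (n k) - 1))
        \<le> (\<Sum>i<N. M + \<delta> / 2 + 2 * (of_bool (k < K (Suc i)) - of_bool (k < K i)))"
      by (rule sum_mono)
    also have "\<dots> = real N * (M + \<delta> / 2) + 2 * (of_bool (k < K N) - of_bool (k < K 0))"
      using sum_lessThan_telescope[of "\<lambda>i. of_bool (k < K i) :: real" N]
      unfolding sum.distrib sum_distrib_left[symmetric] by (simp add: algebra_simps)
    also have "\<dots> \<le> real N * (M + \<delta> / 2) + 2"
      by (simp add: K_def)
    finally have "(\<Sum>i<N. cmod (fourier_coeff (\<rho> i) (n k) - 1)) / real N \<le> (real N * (M + \<delta> / 2) + 2) / real N"
      by (rule divide_right_mono) simp
    also have "\<dots> = M + \<delta> / 2 + 2 / real N"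
      using N_pos by (simp add: field_simps)
    finally show "cmod (fourier_coeff \<nu> (n k) - 1) \<le> max (cmod (fourier_coeff \<mu> (n k) - 1)) \<epsilon> + \<delta>"
      using fc_le[of "n k"] N_large unfolding M_def by linarith
  qed
qed

section \<open>The limit measure\<close>

text \<open>Both properties of the limit come from bounds that hold at all late stages
  simultaneously: recorded conditions are never dropped, and the permitted losses \<open>h p\<close>
  form a convergent geometric series.\<close>

lemma dense_imp_rigidity_sequence:
  assumes dense: "\<And>\<epsilon>. \<epsilon> > 0 \<Longrightarrow> weak_topology closure_of (rigidity_set n \<epsilon>) = circle_prob"
  shows "rigidity_sequence n"
proof -
  define e where "e \<mu> k = cmod (fourier_coeff \<mu> (n k) - 1)" for \<mu> k
  define h :: "nat \<Rightarrow> real" where "h p = (1/2) ^ p" for p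
  have h_pos: "h p > 0" for p by (simp add: h_def)
  define Inv where "Inv = (\<lambda>(\<mu>, G). \<mu> \<in> circle_prob \<and> admissible G \<and> satisfies \<mu> G)"
  \<comment> \<open>The inclusion \<open>G \<subseteq> H\<close> makes an atom test, once recorded,
    bind every later measure.\<close>
  define Next where "Next p = (\<lambda>(\<mu>, G) (\<nu>, H). G \<subseteq> H \<and> atom_test (h p) H \<and>
    (\<forall>\<^sub>F k in sequentially. e \<nu> k \<le> h p) \<and> (\<forall>k. e \<nu> k \<le> max (e \<mu> k) (h p) + h p))" for p
  have "\<exists>S. \<forall>p. Inv (S p) \<and> Next p (S p) (S (Suc p))"
  proof (rule dependent_nat_choice)
    have "arc_measure 0 1 \<in> circle_prob"
      using arc_measure_circle_prob_cont[of 1 0] by (simp add: circle_prob_cont_def)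
    then have "Inv (arc_measure 0 1, {})"
      by (simp add: Inv_def admissible_def satisfies_def)
    then show "\<exists>x. Inv x" by blast
  next
    fix x p assume "Inv x"
    then obtain \<mu> G where x: "x = (\<mu>, G)" "\<mu> \<in> circle_prob" "admissible G" "satisfies \<mu> G"
      by (auto simp: Inv_def)
    \<comment> \<open>The improvement step bounds atoms non-strictly, while an atom test needs a
      strict bound; asking for \<open>h p / 2\<close> leaves the room.\<close>
    obtain \<nu> where \<nu>: "\<nu> \<in> circle_prob" "satisfies \<nu> G"
        "\<And>z. z \<in> unit_circle \<Longrightarrow> measure \<nu> {z} \<le> h p / 2"
        "\<forall>\<^sub>F k in sequentially. e \<nu> k \<le> h p" "\<And>k. e \<nu> k \<le> max (e \<mu> k) (h p) + h p"
      unfolding e_def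
      using rigidity_improvement_step[OF dense[OF h_pos[of p]] x(2-4) h_pos[of p] half_gt_zero[OF h_pos[of p]]]
      by metis
    have "measure \<nu> {z} < h p" if "z \<in> unit_circle" for z
      using \<nu>(3)[OF that] h_pos[of p] by linarith
    then obtain H where "admissible H" "satisfies \<nu> H" "atom_test (h p) H"
      using atom_test_exists[OF \<nu>(1)] by metis
    then have "Inv (\<nu>, G \<union> H) \<and> Next p x (\<nu>, G \<union> H)"
      using \<nu> x unfolding Inv_def Next_def atom_test_def by (simp, blast)
    then show "\<exists>y. Inv y \<and> Next p x y" by blast
  qed
  then obtain S where S: "\<And>p. Inv (S p)" "\<And>p. Next p (S p) (S (Suc p))"
    by blast
  define X G where "X p = fst (S p)" and "G p = snd (S p)" for p
  have X: "X p \<in> circle_prob" "admissible (G p)" "satisfies (X p) (G p)" for p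
    using S(1)[of p] by (auto simp: Inv_def X_def G_def split: prod.splits)
  have step: "G p \<subseteq> G (Suc p)" "atom_test (h p) (G (Suc p))"
      "\<forall>\<^sub>F k in sequentially. e (X (Suc p)) k \<le> h p" 
      "e (X (Suc p)) k \<le> max (e (X p) k) (h p) + h p" for p k
    using S(2)[of p] by (auto simp: Next_def X_def G_def split: prod.splits)
  have G_mono: "G p \<subseteq> G q" if "p \<le> q" for p q
    using that step(1) by (rule lift_Suc_mono_le[rotated])
  \<comment> \<open>The losses from stage \<open>Suc q\<close> up to stage \<open>p\<close> are
    \<open>h (Suc q) + ... + h (p - 1) = h q - 2 * h p\<close>. Keeping the negative term lets the
    induction close; the later maxima with \<open>h p\<close> are absorbed because
    \<open>h p \<le> h q / 2\<close>.\<close>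
  have e_bound: "e (X p) k \<le> max (e (X (Suc q)) k) (h q) + h q - 2 * h p" if "p \<ge> Suc q" for p q k
    using that
  proof (induction p rule: dec_induct)
    case base
    show ?case by (simp add: h_def)
  next
    case (step p)
    have "h p \<le> h (Suc q)"
      unfolding h_def using step.hyps by (intro power_decreasing) auto
    moreover have "h (Suc q) = h q / 2" "h (Suc p) = h p / 2"
      by (simp_all add: h_def)
    ultimately show ?case
      using step.IH h_pos[of q] \<open>\<And>p k. e (X (Suc p)) k \<le> max (e (X p) k) (h p) + h p\<close>[of p k] by linarith
  qed
  obtain r \<mu> where r: "strict_mono r" and lim: "limitin weak_topology (X \<circ> r) \<mu> sequentially"
    by (rule circle_prob_seq_compact[OF X(1)])
  then have \<mu>: "\<mu> \<in> circle_prob"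
    and conv: "\<And>f :: complex \<Rightarrow> real. continuous_on unit_circle f \<Longrightarrow>
      (\<lambda>i. \<integral>z. f z \<partial>X (r i)) \<longlonglongrightarrow> (\<integral>z. f z \<partial>\<mu>)"
    unfolding limitin_weak_topology by auto
  have "emeasure \<mu> {z} = 0" if z: "z \<in> unit_circle" for z
  proof -
    interpret prob_space \<mu> using \<mu> by (simp add: circle_probD)
    have "measure \<mu> {z} \<le> h p" for p
    proof -
      obtain f where f: "(f, h p) \<in> G (Suc p)" "\<forall>x\<in>unit_circle. 0 \<le> f x" "1 \<le> f z"
        using step(2)[of p] z unfolding atom_test_def by blast
      then have cont: "continuous_on unit_circle f"
        using X(2)[of "Suc p"] by (auto simp: admissible_def)
      \<comment> \<open>One fixed test function bounds all stages from \<open>Suc p\<close> on, so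
        its bound reaches the weak limit.\<close>
      have "(\<integral>x. f x \<partial>X q) < h p" if "q \<ge> Suc p" for q
        using X(3)[of q] G_mono[OF that] f(1) by (auto simp: satisfies_def)
      then have "\<forall>\<^sub>F i in sequentially. (\<integral>x. f x \<partial>X (r i)) \<le> h p"
        using seq_suble[OF r] unfolding eventually_sequentially
        by (meson less_imp_le order_trans)
      then have "(\<integral>x. f x \<partial>\<mu>) \<le> h p"
        using conv[OF cont] by (intro tendsto_upperbound[OF _ _ sequentially_bot])
      then show ?thesis
        using atom_le_integral[OF \<mu> cont _ z] f by force
    qed
    moreover have "h \<longlonglongrightarrow> 0"
      unfolding h_def by (rule LIMSEQ_power_zero) simp
    ultimately have "measure \<mu> {z} \<le> 0"
      by (intro tendsto_lowerbound[OF _ _ sequentially_bot]) auto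
    then show ?thesis
      by (simp add: emeasure_eq_measure measure_le_0_iff)
  qed
  moreover have "(\<lambda>k. fourier_coeff \<mu> (n k)) \<longlonglongrightarrow> 1"
  proof -
    have conv_fc: "(\<lambda>i. fourier_coeff (X (r i)) m) \<longlonglongrightarrow> fourier_coeff \<mu> m" for m
      unfolding tendsto_complex_iff Re_Im_fourier_coeff[OF X(1)] Re_Im_fourier_coeff[OF \<mu>]
      by (intro conjI conv continuous_intros) auto
    \<comment> \<open>The threshold for \<open>k\<close> comes from the single stage
      \<open>Suc q\<close>, after which \<open>e_bound\<close> holds the error below
      \<open>2 * h q\<close> at every later stage. Hence \<open>k\<close> can be fixed while the
      stage tends to infinity.\<close>
    have e_\<mu>: "\<forall>\<^sub>F k in sequentially. e \<mu> k \<le> 2 * h q" for q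
      using step(3)[of q]
    proof eventually_elim
      case (elim k)
      have "e (X p) k \<le> 2 * h q" if "p \<ge> Suc q" for p
        using e_bound[OF that, of k] elim h_pos[of p] by simp
      then have "\<forall>\<^sub>F i in sequentially. e (X (r i)) k \<le> 2 * h q"
        using seq_suble[OF r] unfolding eventually_sequentially by (meson order_trans)
      moreover have "(\<lambda>i. e (X (r i)) k) \<longlonglongrightarrow> e \<mu> k"
        unfolding e_def by (intro tendsto_intros conv_fc)
      ultimately show ?case
        by (intro tendsto_upperbound[OF _ _ sequentially_bot])
    qed
    have "\<forall>\<^sub>F k in sequentially. e \<mu> k < d" if "d > 0" for d
    proof -
      obtain q where "2 * h q < d"
        using real_arch_pow_inv[of "d / 2" "1/2"] \<open>d > 0\<close> by (auto simp: h_def mult.commute)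
      with e_\<mu>[of q] show ?thesis
        by (auto elim!: eventually_mono)
    qed
    then show ?thesis
      unfolding e_def tendsto_iff dist_norm by blast
  qed
  ultimately show ?thesis
    using \<mu> by (auto simp: rigidity_sequence_def circle_prob_cont_def)
qed

theorem theorem4p3:
  fixes n :: "nat \<Rightarrow> int"
  shows "rigidity_sequence n \<longleftrightarrow>
    (\<forall>\<epsilon>>0. weak_topology closure_of (rigidity_set n \<epsilon>) = circle_prob)"
  using rigidity_sequence_imp_dense dense_imp_rigidity_sequence by blast

end
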